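(* There exists an injective functor from the category $\mathcal{QS}_{red}$ to the category $\mathcal{S}_{ab}$.
   Context: $\mathcal{S}_{ab}$ is the category whose objects are the discrete abelian cancellative semigroups $S$ (with neutral element $0$ and torsion-free group of differences $\Gamma=S-S$) and whose morphisms are semigroup homomorphisms. For such $S$, $\{e_a\}_{a\in S}$ is the canonical orthonormal basis of $\ell^2(S)$, $T_a$ ($a\in S$) is the isometry $T_ae_b=e_{a+b}$, and $C^*_{red}(S)\subseteq B(\ell^2(S))$ is the $C^*$-algebra generated by all $T_a,T_a^*$. A monomial is a finite product of operators $T_a$ and $T_b^*$ ($a,b\in S$). $\Delta\colon C^*_{red}(S)\to C^*_{red}(S)\otimes C^*_{red}(S)$ (minimal tensor product) is the continuous extension of the map $\sum_i\lambda_iV_i\mapsto\sum_i\lambda_iV_i\otimes V_i$ on finite linear combinations of monomials $V_i$. $\mathcal{QS}_{red}$ is the category whose objects are the compact quantum semigroups $(C^*_{red}(S),\Delta)$ for all $S\in\mathrm{Obj}(\mathcal{S}_{ab})$, and whose morphisms $(C^*_{red}(S_1),\Delta_1)\to(C^*_{red}(S_2),\Delta_2)$ are the unital $*$-homomorphisms $\pi\colon C^*_{red}(S_1)\to C^*_{red}(S_2)$ with $\Delta_2\pi=(\pi\otimes\pi)\Delta_1$. A functor is called injective if it is injective on objects and on morphisms.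
   Formalization: Objects of QS_red are taken only for those S (with elements in an arbitrary fixed set) for which the continuous extension Δ exists; it does not exist for every S, e.g. not for S = {0,2,3,4,...}, where V ↦ V⊗V does not respect a linear relation between monomials. *)

theory Defs
  imports
    "HOL-Analysis.Infinite_Sum"
    "HOL-Algebra.Group"
    "HOL-Library.FuncSet"
    "HOL-Library.Function_Algebras"
begin

section \<open>Categories and injective functors\<close>

text \<open>\<open>Comp C g f\<close> is the composite of \<open>f\<close> followed by \<open>g\<close>.\<close>

record ('o, 'm) cat =
  Obj :: "'o set"
  Arr :: "'m set"
  Dom :: "'m \<Rightarrow> 'o"
  Cod :: "'m \<Rightarrow> 'o"
  Ident :: "'o \<Rightarrow> 'm"
  Comp :: "'m \<Rightarrow> 'm \<Rightarrow> 'm"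

locale category =
  fixes C :: "('o, 'm) cat"
  assumes dom_obj: "f \<in> Arr C \<Longrightarrow> Dom C f \<in> Obj C"
    and cod_obj: "f \<in> Arr C \<Longrightarrow> Cod C f \<in> Obj C"
    and ident_arr: "X \<in> Obj C \<Longrightarrow> Ident C X \<in> Arr C"
    and dom_ident: "X \<in> Obj C \<Longrightarrow> Dom C (Ident C X) = X"
    and cod_ident: "X \<in> Obj C \<Longrightarrow> Cod C (Ident C X) = X"
    and comp_arr:
      "\<lbrakk>f \<in> Arr C; g \<in> Arr C; Cod C f = Dom C g\<rbrakk> \<Longrightarrow> Comp C g f \<in> Arr C"
    and dom_comp:
      "\<lbrakk>f \<in> Arr C; g \<in> Arr C; Cod C f = Dom C g\<rbrakk> \<Longrightarrow> Dom C (Comp C g f) = Dom C f"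
    and cod_comp:
      "\<lbrakk>f \<in> Arr C; g \<in> Arr C; Cod C f = Dom C g\<rbrakk> \<Longrightarrow> Cod C (Comp C g f) = Cod C g"
    and comp_ident_dom: "f \<in> Arr C \<Longrightarrow> Comp C f (Ident C (Dom C f)) = f"
    and comp_ident_cod: "f \<in> Arr C \<Longrightarrow> Comp C (Ident C (Cod C f)) f = f"
    and comp_assoc:
      "\<lbrakk>f \<in> Arr C; g \<in> Arr C; h \<in> Arr C; Cod C f = Dom C g; Cod C g = Dom C h\<rbrakk>
        \<Longrightarrow> Comp C h (Comp C g f) = Comp C (Comp C h g) f"

locale cat_functor = C: category C + D: category D
  for C :: "('o1, 'm1) cat" and D :: "('o2, 'm2) cat" +
  fixes Fo :: "'o1 \<Rightarrow> 'o2" and Fm :: "'m1 \<Rightarrow> 'm2"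
  assumes obj_map: "X \<in> Obj C \<Longrightarrow> Fo X \<in> Obj D"
    and arr_map: "f \<in> Arr C \<Longrightarrow> Fm f \<in> Arr D"
    and dom_map: "f \<in> Arr C \<Longrightarrow> Dom D (Fm f) = Fo (Dom C f)"
    and cod_map: "f \<in> Arr C \<Longrightarrow> Cod D (Fm f) = Fo (Cod C f)"
    and ident_map: "X \<in> Obj C \<Longrightarrow> Fm (Ident C X) = Ident D (Fo X)"
    and comp_map:
      "\<lbrakk>f \<in> Arr C; g \<in> Arr C; Cod C f = Dom C g\<rbrakk>
        \<Longrightarrow> Fm (Comp C g f) = Comp D (Fm g) (Fm f)"

locale injective_functor = cat_functor +
  assumes inj_obj: "inj_on Fo (Obj C)"
    and inj_arr: "inj_on Fm (Arr C)"

section \<open>The category of semigroups\<close>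

text \<open>The group of differences \<open>S - S\<close>: formal differences \<open>a - b\<close>, with
  \<open>a - b = c - d\<close> iff \<open>a + d = c + b\<close>. Semigroups are written multiplicatively, as
  in HOL-Algebra.\<close>

definition diff_rel :: "'a monoid \<Rightarrow> (('a \<times> 'a) \<times> ('a \<times> 'a)) set" where
  "diff_rel S = {((a, b), (c, d)) | a b c d.
     a \<in> carrier S \<and> b \<in> carrier S \<and> c \<in> carrier S \<and> d \<in> carrier S \<and>
     a \<otimes>\<^bsub>S\<^esub> d = c \<otimes>\<^bsub>S\<^esub> b}"

definition diff_group :: "'a monoid \<Rightarrow> ('a \<times> 'a) set monoid" where
  "diff_group S =
    \<lparr>carrier = (carrier S \<times> carrier S) // diff_rel S,
     monoid.mult = (\<lambda>X Y. \<Union>(a, b)\<in>X. \<Union>(c, d)\<in>Y.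
                      diff_rel S `` {(a \<otimes>\<^bsub>S\<^esub> c, b \<otimes>\<^bsub>S\<^esub> d)}),
     one = diff_rel S `` {(\<one>\<^bsub>S\<^esub>, \<one>\<^bsub>S\<^esub>)}\<rparr>"

definition torsion_free :: "'g monoid \<Rightarrow> bool" where
  "torsion_free G \<longleftrightarrow>
    (\<forall>x\<in>carrier G. \<forall>n::nat. n > 0 \<and> x [^]\<^bsub>G\<^esub> n = \<one>\<^bsub>G\<^esub> \<longrightarrow> x = \<one>\<^bsub>G\<^esub>)"

text \<open>The last condition fixes the irrelevant values of the multiplication outside the
  carrier, so that equality of records is equality of semigroups.\<close>

definition sab_semigroup :: "'a monoid \<Rightarrow> bool" where
  "sab_semigroup S \<longleftrightarrow>
    comm_monoid S \<and>
    (\<forall>a\<in>carrier S. \<forall>b\<in>carrier S. \<forall>c\<in>carrier S.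
       a \<otimes>\<^bsub>S\<^esub> b = a \<otimes>\<^bsub>S\<^esub> c \<longrightarrow> b = c) \<and>
    torsion_free (diff_group S) \<and>
    (\<forall>a b. \<not> (a \<in> carrier S \<and> b \<in> carrier S) \<longrightarrow> a \<otimes>\<^bsub>S\<^esub> b = undefined)"

text \<open>Arrows are triples (domain, map, codomain), the map being extensional. Maps in \<open>hom\<close>
  only preserve the multiplication; by cancellation they preserve the neutral element.\<close>

definition S_ab :: "('a monoid, 'a monoid \<times> ('a \<Rightarrow> 'a) \<times> 'a monoid) cat" where
  "S_ab =
    \<lparr>Obj = {S. sab_semigroup S},
     Arr = {(S, \<phi>, R). sab_semigroup S \<and> sab_semigroup R \<and>
              \<phi> \<in> hom S R \<and> \<phi> \<in> extensional (carrier S)},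
     Dom = (\<lambda>(S, \<phi>, R). S),
     Cod = (\<lambda>(S, \<phi>, R). R),
     Ident = (\<lambda>S. (S, restrict (\<lambda>a. a) (carrier S), S)),
     Comp = (\<lambda>(R, \<psi>, Q) (S, \<phi>, R'). (S, compose (carrier S) \<psi> \<phi>, Q))\<rparr>"

section \<open>Bounded operators on $\ell^2$ spaces\<close>

text \<open>\<open>ell2 I\<close> consists of square-summable functions vanishing outside \<open>I\<close>. An operator on
  \<open>ell2 I\<close> is a function on all of \<open>'a \<Rightarrow> complex\<close> that vanishes outside \<open>ell2 I\<close>; with this
  convention sums and differences are the pointwise ones and products are compositions, and
  the operator norm takes the library's form of \<open>onorm\<close>.\<close>

type_synonym 'a oper = "('a \<Rightarrow> complex) \<Rightarrow> ('a \<Rightarrow> complex)"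

definition ell2 :: "'a set \<Rightarrow> ('a \<Rightarrow> complex) set" where
  "ell2 I = {f. (\<forall>x. x \<notin> I \<longrightarrow> f x = 0) \<and> (\<lambda>x. (cmod (f x))\<^sup>2) summable_on UNIV}"

definition l2norm :: "('a \<Rightarrow> complex) \<Rightarrow> real" where
  "l2norm f = sqrt (\<Sum>\<^sub>\<infinity>x. (cmod (f x))\<^sup>2)"

definition l2inner :: "('a \<Rightarrow> complex) \<Rightarrow> ('a \<Rightarrow> complex) \<Rightarrow> complex" where
  "l2inner f g = (\<Sum>\<^sub>\<infinity>x. cnj (f x) * g x)"

definition ket :: "'a \<Rightarrow> ('a \<Rightarrow> complex)" where
  "ket a = (\<lambda>x. if x = a then 1 else 0)"

definition bounded_ops :: "'a set \<Rightarrow> 'a oper set" where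
  "bounded_ops I = {A.
     (\<forall>f\<in>ell2 I. A f \<in> ell2 I) \<and>
     (\<forall>f. f \<notin> ell2 I \<longrightarrow> A f = 0) \<and>
     (\<forall>f\<in>ell2 I. \<forall>g\<in>ell2 I. A (f + g) = A f + A g) \<and>
     (\<forall>c. \<forall>f\<in>ell2 I. A (\<lambda>x. c * f x) = (\<lambda>x. c * A f x)) \<and>
     (\<exists>K. \<forall>f\<in>ell2 I. l2norm (A f) \<le> K * l2norm f)}"

definition opnorm :: "'a oper \<Rightarrow> real" where
  "opnorm A = (SUP f. l2norm (A f) / l2norm f)"

definition scale_op :: "complex \<Rightarrow> 'a oper \<Rightarrow> 'a oper" where
  "scale_op c A = (\<lambda>f x. c * A f x)"

definition id_op :: "'a set \<Rightarrow> 'a oper" where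
  "id_op I = (\<lambda>f. if f \<in> ell2 I then f else 0)"

definition adj_op :: "'a set \<Rightarrow> 'a oper \<Rightarrow> 'a oper" where
  "adj_op I A = (THE B. B \<in> bounded_ops I \<and>
     (\<forall>f\<in>ell2 I. \<forall>g\<in>ell2 I. l2inner (A f) g = l2inner f (B g)))"

definition op_tendsto :: "(nat \<Rightarrow> 'a oper) \<Rightarrow> 'a oper \<Rightarrow> bool" where
  "op_tendsto X A \<longleftrightarrow> (\<lambda>n. opnorm (X n - A)) \<longlonglongrightarrow> 0"

definition op_continuous_on :: "'a oper set \<Rightarrow> ('a oper \<Rightarrow> 'b oper) \<Rightarrow> bool" where
  "op_continuous_on \<A> \<Phi> \<longleftrightarrow>
    (\<forall>X A. (\<forall>n. X n \<in> \<A>) \<and> A \<in> \<A> \<and> op_tendsto X A \<longrightarrow> op_tendsto (\<lambda>n. \<Phi> (X n)) (\<Phi> A))"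

text \<open>The C*-algebra of operators on \<open>ell2 I\<close> generated by \<open>G\<close>.\<close>

inductive_set cstar_gen :: "'a set \<Rightarrow> 'a oper set \<Rightarrow> 'a oper set"
  for I :: "'a set" and G :: "'a oper set" where
  gen: "A \<in> G \<Longrightarrow> A \<in> cstar_gen I G"
| add: "\<lbrakk>A \<in> cstar_gen I G; B \<in> cstar_gen I G\<rbrakk> \<Longrightarrow> A + B \<in> cstar_gen I G"
| scale: "A \<in> cstar_gen I G \<Longrightarrow> scale_op c A \<in> cstar_gen I G"
| mult: "\<lbrakk>A \<in> cstar_gen I G; B \<in> cstar_gen I G\<rbrakk> \<Longrightarrow> A \<circ> B \<in> cstar_gen I G"
| adj: "A \<in> cstar_gen I G \<Longrightarrow> adj_op I A \<in> cstar_gen I G"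
| lim: "\<lbrakk>\<And>n. X n \<in> cstar_gen I G; A \<in> bounded_ops I; op_tendsto X A\<rbrakk>
         \<Longrightarrow> A \<in> cstar_gen I G"

text \<open>The Hilbert space tensor product of \<open>ell2 I\<close> and \<open>ell2 J\<close> is realised as
  \<open>ell2 (I \<times> J)\<close>, and the minimal tensor product of concrete C*-algebras as the spatial one.\<close>

definition tensor_vec :: "('a \<Rightarrow> complex) \<Rightarrow> ('b \<Rightarrow> complex) \<Rightarrow> ('a \<times> 'b \<Rightarrow> complex)" where
  "tensor_vec f g = (\<lambda>(x, y). f x * g y)"

definition tensor_op :: "'a set \<Rightarrow> 'b set \<Rightarrow> 'a oper \<Rightarrow> 'b oper \<Rightarrow> ('a \<times> 'b) oper" where
  "tensor_op I J A B = (THE C. C \<in> bounded_ops (I \<times> J) \<and>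
     (\<forall>f\<in>ell2 I. \<forall>g\<in>ell2 J. C (tensor_vec f g) = tensor_vec (A f) (B g)))"

definition min_tensor ::
  "'a set \<Rightarrow> 'b set \<Rightarrow> 'a oper set \<Rightarrow> 'b oper set \<Rightarrow> ('a \<times> 'b) oper set" where
  "min_tensor I J \<A> \<B> = cstar_gen (I \<times> J) {tensor_op I J A B | A B. A \<in> \<A> \<and> B \<in> \<B>}"

section \<open>The reduced semigroup C*-algebra and its comultiplication\<close>

definition T_op :: "'a monoid \<Rightarrow> 'a \<Rightarrow> 'a oper" where
  "T_op S a = (THE A. A \<in> bounded_ops (carrier S) \<and>
     (\<forall>b\<in>carrier S. A (ket b) = ket (a \<otimes>\<^bsub>S\<^esub> b)))"

definition T_adj :: "'a monoid \<Rightarrow> 'a \<Rightarrow> 'a oper" where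
  "T_adj S a = adj_op (carrier S) (T_op S a)"

definition C_red :: "'a monoid \<Rightarrow> 'a oper set" where
  "C_red S = cstar_gen (carrier S) (T_op S ` carrier S \<union> T_adj S ` carrier S)"

inductive_set monomials :: "'a monoid \<Rightarrow> 'a oper set" for S :: "'a monoid" where
  shift: "a \<in> carrier S \<Longrightarrow> T_op S a \<in> monomials S"
| shift_adj: "a \<in> carrier S \<Longrightarrow> T_adj S a \<in> monomials S"
| prod: "\<lbrakk>V \<in> monomials S; W \<in> monomials S\<rbrakk> \<Longrightarrow> V \<circ> W \<in> monomials S"

text \<open>\<open>is_comult S \<Delta>\<close>: the map \<open>\<Delta>\<close> (extensional on \<open>C_red S\<close>) is the continuous extension
  of \<open>\<Sum>i \<lambda>i Vi \<mapsto> \<Sum>i \<lambda>i Vi \<otimes> Vi\<close>. There is at most one such map. There need not be any: for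
  the numerical semigroup \<open>{0, 2, 3, ...}\<close> the monomials are linearly dependent in a way that
  the assignment does not respect.\<close>

definition is_comult :: "'a monoid \<Rightarrow> ('a oper \<Rightarrow> ('a \<times> 'a) oper) \<Rightarrow> bool" where
  "is_comult S \<Delta> \<longleftrightarrow>
    \<Delta> \<in> extensional (C_red S) \<and>
    (\<forall>x\<in>C_red S. \<Delta> x \<in> min_tensor (carrier S) (carrier S) (C_red S) (C_red S)) \<and>
    op_continuous_on (C_red S) \<Delta> \<and>
    (\<forall>(n::nat) c V. (\<forall>i<n. V i \<in> monomials S) \<longrightarrow>
       \<Delta> (\<Sum>i<n. scale_op (c i) (V i)) =
       (\<Sum>i<n. scale_op (c i) (tensor_op (carrier S) (carrier S) (V i) (V i))))"

section \<open>The category of quantum semigroups\<close>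

text \<open>A concrete C*-algebra with a comultiplication. The index set of the underlying space
  \<open>ell2 (idx Q)\<close> is recorded because adjoints and tensor products refer to it; it is
  determined by the operators in a unital algebra on that space.\<close>

record 'a qsemigroup =
  idx :: "'a set"
  alg :: "'a oper set"
  comult :: "'a oper \<Rightarrow> ('a \<times> 'a) oper"

definition qs_objects :: "'a qsemigroup set" where
  "qs_objects = {\<lparr>idx = carrier S, alg = C_red S, comult = \<Delta>\<rparr> | S \<Delta>.
     sab_semigroup S \<and> is_comult S \<Delta>}"

definition unital_star_hom ::
  "'a qsemigroup \<Rightarrow> 'a qsemigroup \<Rightarrow> ('a oper \<Rightarrow> 'a oper) \<Rightarrow> bool" where
  "unital_star_hom P Q \<pi> \<longleftrightarrow>
    (\<forall>x\<in>alg P. \<pi> x \<in> alg Q) \<and>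
    (\<forall>x\<in>alg P. \<forall>y\<in>alg P. \<pi> (x + y) = \<pi> x + \<pi> y) \<and>
    (\<forall>c. \<forall>x\<in>alg P. \<pi> (scale_op c x) = scale_op c (\<pi> x)) \<and>
    (\<forall>x\<in>alg P. \<forall>y\<in>alg P. \<pi> (x \<circ> y) = \<pi> x \<circ> \<pi> y) \<and>
    (\<forall>x\<in>alg P. \<pi> (adj_op (idx P) x) = adj_op (idx Q) (\<pi> x)) \<and>
    \<pi> (id_op (idx P)) = id_op (idx Q)"

definition alg_tensor :: "'a qsemigroup \<Rightarrow> ('a \<times> 'a) oper set" where
  "alg_tensor Q = min_tensor (idx Q) (idx Q) (alg Q) (alg Q)"

text \<open>\<open>is_tensor_map P Q \<pi> \<Theta>\<close>: on \<open>alg_tensor P\<close>, the map \<open>\<Theta>\<close> is \<open>\<pi> \<otimes> \<pi>\<close>, that is, the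
  continuous linear map with \<open>x \<otimes> y \<mapsto> \<pi> x \<otimes> \<pi> y\<close>. For a *-homomorphism \<open>\<pi>\<close> it exists and is
  unique.\<close>

definition is_tensor_map ::
  "'a qsemigroup \<Rightarrow> 'a qsemigroup \<Rightarrow> ('a oper \<Rightarrow> 'a oper) \<Rightarrow>
   (('a \<times> 'a) oper \<Rightarrow> ('a \<times> 'a) oper) \<Rightarrow> bool" where
  "is_tensor_map P Q \<pi> \<Theta> \<longleftrightarrow>
    (\<forall>x\<in>alg_tensor P. \<Theta> x \<in> alg_tensor Q) \<and>
    (\<forall>x\<in>alg_tensor P. \<forall>y\<in>alg_tensor P. \<Theta> (x + y) = \<Theta> x + \<Theta> y) \<and>
    (\<forall>c. \<forall>x\<in>alg_tensor P. \<Theta> (scale_op c x) = scale_op c (\<Theta> x)) \<and>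
    op_continuous_on (alg_tensor P) \<Theta> \<and>
    (\<forall>x\<in>alg P. \<forall>y\<in>alg P.
       \<Theta> (tensor_op (idx P) (idx P) x y) = tensor_op (idx Q) (idx Q) (\<pi> x) (\<pi> y))"

definition qs_hom :: "'a qsemigroup \<Rightarrow> 'a qsemigroup \<Rightarrow> ('a oper \<Rightarrow> 'a oper) set" where
  "qs_hom P Q = {\<pi>. \<pi> \<in> extensional (alg P) \<and> unital_star_hom P Q \<pi> \<and>
     (\<exists>\<Theta>. is_tensor_map P Q \<pi> \<Theta> \<and>
        (\<forall>x\<in>alg P. comult Q (\<pi> x) = \<Theta> (comult P x)))}"

definition QS_red ::
  "('a qsemigroup, 'a qsemigroup \<times> ('a oper \<Rightarrow> 'a oper) \<times> 'a qsemigroup) cat" where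
  "QS_red =
    \<lparr>Obj = qs_objects,
     Arr = {(P, \<pi>, Q). P \<in> qs_objects \<and> Q \<in> qs_objects \<and> \<pi> \<in> qs_hom P Q},
     Dom = (\<lambda>(P, \<pi>, Q). P),
     Cod = (\<lambda>(P, \<pi>, Q). Q),
     Ident = (\<lambda>P. (P, restrict (\<lambda>x. x) (alg P), P)),
     Comp = (\<lambda>(Q, \<rho>, R) (P, \<pi>, Q'). (P, compose (alg P) \<rho> \<pi>, R))\<rparr>"

end

theory Submission
  imports Defs "HOL-Analysis.L2_Norm"
begin

text \<open>A semigroup \<open>S\<close> can be read off from \<open>(C_red S, \<Delta>)\<close>: the isometries \<open>x\<close> with
  \<open>\<Delta> x = x \<otimes> x\<close> are exactly the \<open>T\<^sub>a\<close>. Indeed, on monomials, and hence by continuity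
  everywhere, the entries of \<open>\<Delta> x\<close> vanish between different degrees and its diagonal
  entries are the entries of \<open>x\<close>; so the entries of a group-like \<open>x\<close> are \<open>0\<close> or \<open>1\<close> and
  live in one degree. A morphism \<open>\<pi>\<close> preserves group-like isometries, which gives a semigroup
  homomorphism \<open>\<phi>\<close> with \<open>\<pi> T\<^sub>a = T\<^bsub>\<phi> a\<^esub>\<close>, and \<open>\<phi>\<close> determines \<open>\<pi>\<close> on the generators.\<close>

section \<open>Square-summable functions\<close>

text \<open>What is read off is a semigroup of isometries without a labelling by
  \<open>carrier S\<close>. On the integers the operations a + b and a + b - 1 have the same set of
  translations, hence the same algebra and the same \<Delta>. An object of \<open>QS_red\<close>
  thus fixes its semigroup only up to isomorphism, and the functor rests on a choice of one
  semigroup per object. Injectivity on objects uses the converse direction: a semigroup determines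
  its algebra, and it determines \<Delta> because combinations of monomials are dense.

  The operator side is governed by matrix entries \<open>A (ket c) c'\<close>. Since
  \<open>T_op\<close>, \<open>adj_op\<close> and \<open>tensor_op\<close> are definite descriptions,
  each needs existence and uniqueness; uniqueness always comes from the Riesz representation, by
  which a bounded operator is determined by its entries. Norm convergence implies convergence of
  entries, and the continuity of \<Delta> is used in this form.\<close>

lemma ell2_bound:
  assumes "\<And>x. x \<notin> I \<Longrightarrow> f x = 0"
    and bound: "\<And>F. finite F \<Longrightarrow> (\<Sum>x\<in>F. (cmod (f x))\<^sup>2) \<le> c"
  shows "f \<in> ell2 I" and "(l2norm f)\<^sup>2 \<le> c"
proof -
  have summ: "(\<lambda>x. (cmod (f x))\<^sup>2) summable_on UNIV"
    by (rule nonneg_bdd_above_summable_on) (auto intro!: bdd_aboveI2[where M = c] bound)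
  then show "f \<in> ell2 I"
    using assms(1) by (simp add: ell2_def)
  have "(\<Sum>\<^sub>\<infinity>x. (cmod (f x))\<^sup>2) \<le> c"
    by (rule infsum_le_finite_sums[OF summ]) (auto intro: bound)
  then show "(l2norm f)\<^sup>2 \<le> c"
    by (simp add: l2norm_def infsum_nonneg)
qed

lemma l2norm_nonneg [simp]: "0 \<le> l2norm f"
  by (simp add: l2norm_def infsum_nonneg)

text \<open>Finite sections are measured by \<open>L2_set\<close>, so that its triangle inequality
  passes to \<open>l2norm\<close> through this criterion. The empty section gives
  \<open>0 \<le> c\<close>, which is what allows squaring.\<close>

lemma l2norm_bound:
  assumes "\<And>x. x \<notin> I \<Longrightarrow> f x = 0"
    and "\<And>F. finite F \<Longrightarrow> L2_set (\<lambda>x. cmod (f x)) F \<le> c"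
  shows "f \<in> ell2 I" and "l2norm f \<le> c"
proof -
  have "0 \<le> c"
    using assms(2)[of "{}"] by simp
  have *: "(\<Sum>x\<in>F. (cmod (f x))\<^sup>2) \<le> c\<^sup>2" if "finite F" for F
    using assms(2)[OF that] \<open>0 \<le> c\<close> by (simp add: L2_set_def real_sqrt_le_iff sqrt_le_D)
  show "f \<in> ell2 I"
    using ell2_bound(1)[of I f "c\<^sup>2"] assms(1) * by blast
  show "l2norm f \<le> c"
    using ell2_bound(2)[of I f "c\<^sup>2"] assms(1) * \<open>0 \<le> c\<close> by (auto intro: power2_le_imp_le)
qed

lemma sum_le_l2norm:
  assumes "f \<in> ell2 I" "finite F"
  shows "(\<Sum>x\<in>F. (cmod (f x))\<^sup>2) \<le> (l2norm f)\<^sup>2"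
  using assms by (auto simp: ell2_def l2norm_def infsum_nonneg intro!: finite_sum_le_infsum)

lemma L2_set_le_l2norm:
  assumes "f \<in> ell2 I" "finite F"
  shows "L2_set (\<lambda>x. cmod (f x)) F \<le> l2norm f"
  using sum_le_l2norm[OF assms] by (simp add: L2_set_def real_le_lsqrt)

lemma norm_le_l2norm: "f \<in> ell2 I \<Longrightarrow> cmod (f x) \<le> l2norm f"
  using L2_set_le_l2norm[of f I "{x}"] by (simp add: L2_set_def)

lemma ell2_outside: "f \<in> ell2 I \<Longrightarrow> x \<notin> I \<Longrightarrow> f x = 0"
  by (simp add: ell2_def)

lemma ell2_add:
  assumes "f \<in> ell2 I" "g \<in> ell2 I"
  shows "f + g \<in> ell2 I" and "l2norm (f + g) \<le> l2norm f + l2norm g"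
proof -
  have "L2_set (\<lambda>x. cmod ((f + g) x)) F \<le> l2norm f + l2norm g" if "finite F" for F
  proof -
    have "L2_set (\<lambda>x. cmod ((f + g) x)) F \<le> L2_set (\<lambda>x. cmod (f x) + cmod (g x)) F"
      by (auto intro: L2_set_mono norm_triangle_ineq)
    also have "\<dots> \<le> L2_set (\<lambda>x. cmod (f x)) F + L2_set (\<lambda>x. cmod (g x)) F"
      by (rule L2_set_triangle_ineq)
    also have "\<dots> \<le> l2norm f + l2norm g"
      using assms that by (intro add_mono L2_set_le_l2norm)
    finally show ?thesis .
  qed
  with l2norm_bound[of I "f + g"] assms
  show "f + g \<in> ell2 I" and "l2norm (f + g) \<le> l2norm f + l2norm g"
    by (auto simp: ell2_outside)
qed

lemma ell2_scale:
  assumes "f \<in> ell2 I"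
  shows "(\<lambda>x. c * f x) \<in> ell2 I" and "l2norm (\<lambda>x. c * f x) = cmod c * l2norm f"
proof -
  have summ: "(\<lambda>x. (cmod (f x))\<^sup>2) summable_on UNIV"
    using assms by (simp add: ell2_def)
  then show "(\<lambda>x. c * f x) \<in> ell2 I"
    using assms by (auto simp: ell2_def norm_mult power_mult_distrib intro: summable_on_cmult_right)
  show "l2norm (\<lambda>x. c * f x) = cmod c * l2norm f"
    by (simp add: l2norm_def norm_mult power_mult_distrib infsum_cmult_right[OF summ]
        real_sqrt_mult)
qed

lemma ell2_zero [simp]: "0 \<in> ell2 I" "l2norm 0 = 0" "(\<lambda>x. 0) \<in> ell2 I" "l2norm (\<lambda>x. 0) = 0"
  by (auto simp: ell2_def l2norm_def)

lemma ell2_diff: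
  assumes "f \<in> ell2 I" "g \<in> ell2 I"
  shows "f - g \<in> ell2 I" and "l2norm (f - g) \<le> l2norm f + l2norm g"
proof -
  have eq: "f - g = f + (\<lambda>x. - 1 * g x)"
    by auto
  show "f - g \<in> ell2 I"
    unfolding eq by (rule ell2_add(1)[OF assms(1) ell2_scale(1)[OF assms(2)]])
  have "l2norm (f - g) \<le> l2norm f + l2norm (\<lambda>x. - 1 * g x)"
    unfolding eq by (rule ell2_add(2)[OF assms(1) ell2_scale(1)[OF assms(2)]])
  then show "l2norm (f - g) \<le> l2norm f + l2norm g"
    by (simp only: ell2_scale(2)[OF assms(2)]) simp
qed

section \<open>Basis vectors and the inner product\<close>

lemma ket_apply [simp]: "ket a a = 1" "x \<noteq> a \<Longrightarrow> ket a x = 0"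
  by (auto simp: ket_def)

lemma ket_inj [simp]: "ket a = ket b \<longleftrightarrow> a = b"
  by (metis ket_apply zero_neq_one)

lemma sum_ket_le: "finite F \<Longrightarrow> (\<Sum>x\<in>F. (cmod (ket a x))\<^sup>2) \<le> 1"
proof -
  assume "finite F"
  then have "(\<Sum>x\<in>F. (cmod (ket a x))\<^sup>2) = (\<Sum>x\<in>F. if x = a then 1 else 0)"
    by (intro sum.cong) (auto simp: ket_def)
  then show ?thesis
    using \<open>finite F\<close> by simp
qed

lemma ket_ell2 [simp]: "a \<in> I \<Longrightarrow> ket a \<in> ell2 I"
  by (rule ell2_bound(1)[of _ _ 1]) (use sum_ket_le in \<open>auto simp: ket_def\<close>)

text \<open>The finite Cauchy-Schwarz inequality bounds all finite sums of
  \<open>cmod (cnj (f x) * g x)\<close> by the product of the norms. Absolute summability follows,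
  and with it both the convergence of the inner product and the estimate.\<close>

lemma
  assumes "f \<in> ell2 I" "g \<in> ell2 I"
  shows l2inner_summable: "(\<lambda>x. cnj (f x) * g x) summable_on UNIV"
    and Cauchy_Schwarz_l2: "cmod (l2inner f g) \<le> l2norm f * l2norm g"
proof -
  have fin: "(\<Sum>x\<in>F. cmod (cnj (f x) * g x)) \<le> l2norm f * l2norm g" if "finite F" for F
  proof -
    have "(\<Sum>x\<in>F. cmod (cnj (f x) * g x)) = (\<Sum>x\<in>F. \<bar>cmod (f x)\<bar> * \<bar>cmod (g x)\<bar>)"
      by (simp add: norm_mult)
    also have "\<dots> \<le> L2_set (\<lambda>x. cmod (f x)) F * L2_set (\<lambda>x. cmod (g x)) F"
      by (rule L2_set_mult_ineq)
    also have "\<dots> \<le> l2norm f * l2norm g"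
      using assms that by (intro mult_mono L2_set_le_l2norm) auto
    finally show ?thesis .
  qed
  have abs: "(\<lambda>x. cmod (cnj (f x) * g x)) summable_on UNIV"
    by (rule nonneg_bdd_above_summable_on)
      (auto intro!: bdd_aboveI2[where M = "l2norm f * l2norm g"] fin simp del: norm_mult)
  then show "(\<lambda>x. cnj (f x) * g x) summable_on UNIV"
    by (rule abs_summable_summable)
  have "cmod (l2inner f g) \<le> (\<Sum>\<^sub>\<infinity>x. cmod (cnj (f x) * g x))"
    unfolding l2inner_def using abs by (rule norm_infsum_bound)
  also have "\<dots> \<le> l2norm f * l2norm g"
    using abs by (rule infsum_le_finite_sums) (rule fin)
  finally show "cmod (l2inner f g) \<le> l2norm f * l2norm g" .
qed

lemma l2inner_add_right:
  assumes "f \<in> ell2 I" "g \<in> ell2 I" "h \<in> ell2 I"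
  shows "l2inner f (g + h) = l2inner f g + l2inner f h"
  using infsum_add[OF l2inner_summable[OF assms(1,2)] l2inner_summable[OF assms(1,3)]]
  by (simp add: l2inner_def algebra_simps)

lemma l2inner_scale_right:
  assumes "f \<in> ell2 I" "g \<in> ell2 I"
  shows "l2inner f (\<lambda>x. c * g x) = c * l2inner f g"
  using infsum_cmult_right[OF l2inner_summable[OF assms], of c]
  by (simp add: l2inner_def algebra_simps)

lemma l2inner_cnj: "cnj (l2inner f g) = l2inner g f"
  unfolding l2inner_def by (subst infsum_cnj[symmetric]) (simp add: mult.commute)

lemma l2inner_ket_left [simp]: "l2inner (ket a) f = f a"
proof -
  have "l2inner (ket a) f = (\<Sum>\<^sub>\<infinity>x\<in>{a}. cnj (ket a x) * f x)"
    unfolding l2inner_def by (rule infsum_cong_neutral) auto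
  then show ?thesis
    by simp
qed

lemma l2inner_ket_right [simp]: "l2inner f (ket a) = cnj (f a)"
  by (metis l2inner_cnj l2inner_ket_left)

section \<open>Riesz representation of bounded functionals\<close>

locale ell2_functional =
  fixes I :: "'a set" and \<Lambda> :: "('a \<Rightarrow> complex) \<Rightarrow> complex" and K :: real
  assumes K_nonneg: "0 \<le> K"
    and add: "f \<in> ell2 I \<Longrightarrow> g \<in> ell2 I \<Longrightarrow> \<Lambda> (f + g) = \<Lambda> f + \<Lambda> g"
    and scale: "f \<in> ell2 I \<Longrightarrow> \<Lambda> (\<lambda>x. c * f x) = c * \<Lambda> f"
    and bound: "f \<in> ell2 I \<Longrightarrow> cmod (\<Lambda> f) \<le> K * l2norm f"
begin

text \<open>The only candidate: \<open>l2inner\<close> is conjugate-linear in its first argument, so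
  a representing vector \<open>r\<close> has \<open>cnj (r x)\<close> as its product with
  \<open>ket x\<close>, and this has to be \<open>\<Lambda> (ket x)\<close>.\<close>

definition representer :: "'a \<Rightarrow> complex" where
  "representer = (\<lambda>x. if x \<in> I then cnj (\<Lambda> (ket x)) else 0)"

definition cut :: "('a \<Rightarrow> complex) \<Rightarrow> 'a set \<Rightarrow> 'a \<Rightarrow> complex" where
  "cut f F = (\<lambda>x. if x \<in> F then f x else 0)"

text \<open>A point \<open>a\<close> of \<open>I\<close> added to \<open>F\<close> contributes the
  vector \<open>f a * ket a\<close>, and a point outside \<open>I\<close> contributes nothing. Of
  \<open>f\<close> only the support is restricted, because the lemma is applied to
  \<open>representer\<close> before its square-summability is known.\<close>

lemma functional_cut:
  assumes "finite F" "\<And>x. x \<notin> I \<Longrightarrow> f x = 0"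
  shows "cut f F \<in> ell2 I" and "\<Lambda> (cut f F) = (\<Sum>x\<in>F. cnj (representer x) * f x)"
proof -
  from assms(1) have "cut f F \<in> ell2 I \<and> \<Lambda> (cut f F) = (\<Sum>x\<in>F. cnj (representer x) * f x)"
  proof induction
    case empty
    have "\<Lambda> (\<lambda>x. 0) = 0"
      using scale[OF ell2_zero(1), of 0] by simp
    then show ?case
      by (simp add: cut_def)
  next
    case (insert a F)
    show ?case
    proof (cases "a \<in> I")
      case True
      have eq: "cut f (insert a F) = (\<lambda>x. f a * ket a x) + cut f F"
        using insert.hyps(2) by (auto simp: cut_def ket_def fun_eq_iff)
      have "(\<lambda>x. f a * ket a x) \<in> ell2 I"
        using True by (simp add: ell2_scale)
      then have "cut f (insert a F) \<in> ell2 I"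
        and "\<Lambda> (cut f (insert a F)) = f a * \<Lambda> (ket a) + \<Lambda> (cut f F)"
        unfolding eq using insert.IH True by (auto simp only: add ell2_add scale ket_ell2)
      then show ?thesis
        using insert True by (simp add: representer_def)
    next
      case False
      then have "cut f (insert a F) = cut f F"
        using assms(2) by (auto simp: cut_def)
      then show ?thesis
        using insert False by (simp add: representer_def)
    qed
  qed
  then show "cut f F \<in> ell2 I" and "\<Lambda> (cut f F) = (\<Sum>x\<in>F. cnj (representer x) * f x)"
    by auto
qed

text \<open>Testing \<open>\<Lambda>\<close> on a truncation of \<open>representer\<close> itself
  returns \<open>s\<close>, the sum of squares over that finite set. Boundedness then reads
  \<open>s \<le> K * sqrt s\<close>, hence \<open>sqrt s \<le> K\<close> for every finite
  set.\<close>

lemma representer_ell2: "representer \<in> ell2 I" and l2norm_representer: "l2norm representer \<le> K"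
proof -
  have out: "representer x = 0" if "x \<notin> I" for x
    using that by (simp add: representer_def)
  have fin: "(\<Sum>x\<in>F. (cmod (representer x))\<^sup>2) \<le> K\<^sup>2" if F: "finite F" for F
  proof -
    define s where "s = (\<Sum>x\<in>F. (cmod (representer x))\<^sup>2)"
    have cut: "cut representer F \<in> ell2 I"
      "\<Lambda> (cut representer F) = (\<Sum>x\<in>F. cnj (representer x) * representer x)"
      using functional_cut[of F representer] F out by blast+
    have s0: "0 \<le> s"
      by (simp add: s_def sum_nonneg)
    have "\<Lambda> (cut representer F) = of_real s"
      unfolding cut(2) s_def of_real_sum complex_norm_square
      by (simp add: mult.commute)
    then have "s \<le> K * l2norm (cut representer F)"
      using bound[OF cut(1)] s0 by simp
    moreover have "(l2norm (cut representer F))\<^sup>2 \<le> s"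
    proof (rule ell2_bound(2)[of I])
      fix G :: "'a set" assume "finite G"
      have "(\<Sum>x\<in>G. (cmod (cut representer F x))\<^sup>2) = (\<Sum>x\<in>G \<inter> F. (cmod (representer x))\<^sup>2)"
        using \<open>finite G\<close> by (intro sum.mono_neutral_cong_right) (auto simp: cut_def)
      also have "\<dots> \<le> s"
        unfolding s_def using F by (intro sum_mono2) auto
      finally show "(\<Sum>x\<in>G. (cmod (cut representer F x))\<^sup>2) \<le> s" .
    qed (auto simp: cut_def representer_def)
    then have "l2norm (cut representer F) \<le> sqrt s"
      by (simp add: real_le_rsqrt)
    ultimately have le: "s \<le> K * sqrt s"
      by (meson K_nonneg mult_left_mono order_trans)
    have "sqrt s \<le> K"
    proof (cases "s = 0")
      case False
      then have "0 < sqrt s"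
        using s0 by simp
      moreover have "sqrt s * sqrt s \<le> K * sqrt s"
        using le s0 by simp
      ultimately show ?thesis
        using mult_le_cancel_right_pos by blast
    qed (simp add: K_nonneg)
    then show ?thesis
      using sqrt_le_D[of s K] by (simp add: s_def)
  qed
  show "representer \<in> ell2 I"
    by (rule ell2_bound(1)[OF out fin])
  have "(l2norm representer)\<^sup>2 \<le> K\<^sup>2"
    by (rule ell2_bound(2)[OF out fin])
  then show "l2norm representer \<le> K"
    using K_nonneg by (rule power2_le_imp_le)
qed

text \<open>The partial sums of the inner product are the values of \<open>\<Lambda>\<close> on
  truncations of \<open>f\<close>. They miss \<open>\<Lambda> f\<close> by at most \<open>K\<close>
  times the norm of the tail, which is bounded by \<open>r F\<close> and tends to 0 along the finite
  sets.\<close>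

lemma functional_eq:
  assumes f: "f \<in> ell2 I"
  shows "\<Lambda> f = l2inner representer f"
proof -
  define r where "r F = sqrt ((l2norm f)\<^sup>2 - (\<Sum>x\<in>F. (cmod (f x))\<^sup>2))" for F
  have "((\<lambda>x. (cmod (f x))\<^sup>2) has_sum (l2norm f)\<^sup>2) UNIV"
    using f by (simp add: ell2_def l2norm_def infsum_nonneg)
  then have "((\<lambda>F. \<Sum>x\<in>F. (cmod (f x))\<^sup>2) \<longlongrightarrow> (l2norm f)\<^sup>2) (finite_subsets_at_top UNIV)"
    by (simp add: has_sum_def)
  then have "(r \<longlongrightarrow> sqrt ((l2norm f)\<^sup>2 - (l2norm f)\<^sup>2)) (finite_subsets_at_top UNIV)"
    unfolding r_def by (intro tendsto_intros)
  then have r0: "((\<lambda>F. K * r F) \<longlongrightarrow> 0) (finite_subsets_at_top UNIV)"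
    by (auto intro: tendsto_mult_right_zero)
  have diff: "cmod ((\<Sum>x\<in>F. cnj (representer x) * f x) - \<Lambda> f) \<le> K * r F" if F: "finite F" for F
  proof -
    have cut: "cut f F \<in> ell2 I" "\<Lambda> (cut f F) = (\<Sum>x\<in>F. cnj (representer x) * f x)"
      using functional_cut[of F f] F ell2_outside[OF f] by blast+
    let ?d = "f - cut f F"
    have d: "?d \<in> ell2 I"
      using f cut(1) by (rule ell2_diff)
    have "(l2norm ?d)\<^sup>2 \<le> (l2norm f)\<^sup>2 - (\<Sum>x\<in>F. (cmod (f x))\<^sup>2)"
    proof (rule ell2_bound(2)[of I])
      fix G :: "'a set" assume "finite G"
      have "(\<Sum>x\<in>G. (cmod (?d x))\<^sup>2) = (\<Sum>x\<in>G - F. (cmod (f x))\<^sup>2)"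
        using \<open>finite G\<close> by (intro sum.mono_neutral_cong_right) (auto simp: cut_def)
      moreover have "(\<Sum>x\<in>G - F. (cmod (f x))\<^sup>2) + (\<Sum>x\<in>F. (cmod (f x))\<^sup>2) = (\<Sum>x\<in>(G - F) \<union> F. (cmod (f x))\<^sup>2)"
        using F \<open>finite G\<close> by (intro sum.union_disjoint[symmetric]) auto
      also have "\<dots> \<le> (l2norm f)\<^sup>2"
        using f F \<open>finite G\<close> by (intro sum_le_l2norm) auto
      ultimately show "(\<Sum>x\<in>G. (cmod (?d x))\<^sup>2) \<le> (l2norm f)\<^sup>2 - (\<Sum>x\<in>F. (cmod (f x))\<^sup>2)"
        by simp
    qed (rule ell2_outside[OF d])
    then have "l2norm ?d \<le> r F"
      by (simp add: r_def real_le_rsqrt)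
    have "cut f F + ?d = f"
      by auto
    then have "\<Lambda> f = \<Lambda> (cut f F) + \<Lambda> ?d"
      using add[OF cut(1) d] by (simp only:)
    then have "(\<Sum>x\<in>F. cnj (representer x) * f x) - \<Lambda> f = - \<Lambda> ?d"
      unfolding cut(2) by (metis add_diff_cancel_left' minus_diff_eq)
    then have "cmod ((\<Sum>x\<in>F. cnj (representer x) * f x) - \<Lambda> f) = cmod (\<Lambda> ?d)"
      by (metis norm_minus_cancel)
    also have "\<dots> \<le> K * r F"
      using bound[OF d] mult_left_mono[OF \<open>l2norm ?d \<le> r F\<close> K_nonneg] by (rule order_trans)
    finally show ?thesis .
  qed
  have "cmod ((\<Sum>x\<in>F. cnj (representer x) * f x) - \<Lambda> f) \<le> norm (K * r F) * 1"
    if "finite F" for F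
    using order_trans[OF diff[OF that] abs_ge_self] by (simp only: mult_1_right real_norm_def)
  then have "((\<lambda>F. (\<Sum>x\<in>F. cnj (representer x) * f x) - \<Lambda> f) \<longlongrightarrow> 0) (finite_subsets_at_top UNIV)"
    by (intro tendsto_0_le[OF r0] eventually_finite_subsets_at_top_weakI)
  then have "((\<lambda>x. cnj (representer x) * f x) has_sum \<Lambda> f) UNIV"
    unfolding has_sum_def by (rule LIM_zero_cancel)
  then show ?thesis
    unfolding l2inner_def by (simp add: infsumI)
qed

end

section \<open>Bounded operators\<close>

lemma bounded_opsI:
  assumes "\<And>f. f \<in> ell2 I \<Longrightarrow> A f \<in> ell2 I"
    and "\<And>f. f \<notin> ell2 I \<Longrightarrow> A f = 0"
    and "\<And>f g. f \<in> ell2 I \<Longrightarrow> g \<in> ell2 I \<Longrightarrow> A (f + g) = A f + A g"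
    and "\<And>c f. f \<in> ell2 I \<Longrightarrow> A (\<lambda>x. c * f x) = (\<lambda>x. c * A f x)"
    and "\<And>f. f \<in> ell2 I \<Longrightarrow> l2norm (A f) \<le> K * l2norm f"
  shows "A \<in> bounded_ops I"
  unfolding bounded_ops_def using assms by blast

lemma
  assumes "A \<in> bounded_ops I"
  shows bounded_ops_ell2: "f \<in> ell2 I \<Longrightarrow> A f \<in> ell2 I"
    and bounded_ops_outside: "f \<notin> ell2 I \<Longrightarrow> A f = 0"
    and bounded_ops_add: "f \<in> ell2 I \<Longrightarrow> g \<in> ell2 I \<Longrightarrow> A (f + g) = A f + A g"
    and bounded_ops_scale: "f \<in> ell2 I \<Longrightarrow> A (\<lambda>x. c * f x) = (\<lambda>x. c * A f x)"
  using assms by (auto simp: bounded_ops_def)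

lemma bounded_ops_zero:
  assumes "A \<in> bounded_ops I"
  shows "A 0 = 0"
  using bounded_ops_scale[OF assms ell2_zero(1), of 0] by (simp add: zero_fun_def)

lemma bounded_ops_apply_outside:
  assumes "A \<in> bounded_ops I" "x \<notin> I"
  shows "A f x = 0"
  using ell2_outside[OF bounded_ops_ell2[OF assms(1)] assms(2)]
  by (cases "f \<in> ell2 I") (simp_all add: bounded_ops_outside[OF assms(1)])

lemma
  assumes A: "A \<in> bounded_ops I"
  shows opnorm_bound: "f \<in> ell2 I \<Longrightarrow> l2norm (A f) \<le> opnorm A * l2norm f"
    and opnorm_nonneg: "0 \<le> opnorm A"
proof -
  obtain K where K: "\<And>f. f \<in> ell2 I \<Longrightarrow> l2norm (A f) \<le> K * l2norm f"
    using A unfolding bounded_ops_def by blast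
  \<comment> \<open>The constant \<open>K\<close> may be negative if \<open>ell2 I\<close> is
    trivial, hence the absolute value. The supremum in \<open>opnorm\<close> ranges over all
    functions: outside \<open>ell2 I\<close> the value of \<open>A\<close> is 0, and division by a
    zero norm yields 0.\<close>
  have "l2norm (A f) / l2norm f \<le> \<bar>K\<bar>" for f
  proof (cases "f \<in> ell2 I")
    case True
    have "l2norm (A f) \<le> \<bar>K\<bar> * l2norm f"
      using K[OF True] mult_right_mono[OF abs_ge_self[of K] l2norm_nonneg[of f]] by linarith
    then show ?thesis
      by (cases "l2norm f = 0") (auto simp: divide_le_eq order_less_le)
  qed (simp add: bounded_ops_outside[OF A])
  then have bdd: "bdd_above (range (\<lambda>f. l2norm (A f) / l2norm f))"
    by (rule bdd_aboveI2)
  show "l2norm (A f) \<le> opnorm A * l2norm f" if f: "f \<in> ell2 I"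
  proof (cases "l2norm f = 0")
    case True
    then show ?thesis
      using K[OF f] by simp
  next
    case False
    then have "0 < l2norm f"
      by (simp add: order_less_le)
    moreover have "l2norm (A f) / l2norm f \<le> opnorm A"
      unfolding opnorm_def by (rule cSUP_upper[OF _ bdd]) simp
    ultimately show ?thesis
      by (simp add: divide_le_eq)
  qed
  have "l2norm (A 0) / l2norm (0 :: 'a \<Rightarrow> complex) \<le> opnorm A"
    unfolding opnorm_def by (rule cSUP_upper[OF _ bdd]) simp
  then show "0 \<le> opnorm A"
    by simp
qed

lemma opnorm_le:
  assumes A: "A \<in> bounded_ops I" and K: "0 \<le> K" "\<And>f. f \<in> ell2 I \<Longrightarrow> l2norm (A f) \<le> K * l2norm f"
  shows "opnorm A \<le> K"
  unfolding opnorm_def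
proof (rule cSUP_least)
  fix f
  show "l2norm (A f) / l2norm f \<le> K"
  proof (cases "f \<in> ell2 I")
    case True
    then show ?thesis
      using K(1) K(2)[OF True] by (cases "l2norm f = 0") (auto simp: divide_le_eq order_less_le)
  qed (simp add: bounded_ops_outside[OF A] K(1))
qed simp

lemma bounded_ops_apply_functional:
  assumes A: "A \<in> bounded_ops I"
  shows "ell2_functional I (\<lambda>f. A f x) (opnorm A)"
proof
  fix f g :: "'a \<Rightarrow> complex" and c
  assume f: "f \<in> ell2 I"
  show "A (\<lambda>x. c * f x) x = c * A f x"
    by (simp add: bounded_ops_scale[OF A f])
  show "cmod (A f x) \<le> opnorm A * l2norm f"
    using norm_le_l2norm[OF bounded_ops_ell2[OF A f]] opnorm_bound[OF A f] by (rule order_trans)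
  assume g: "g \<in> ell2 I"
  show "A (f + g) x = A f x + A g x"
    by (simp add: bounded_ops_add[OF A f g])
qed (rule opnorm_nonneg[OF A])

text \<open>For fixed \<open>x\<close>, the functionals \<open>\<lambda>f. A f x\<close> and
  \<open>\<lambda>f. B f x\<close> have representers computed from basis vectors alone, so they
  coincide. The uniqueness behind every \<open>THE\<close> among the operators is an instance of
  this.\<close>

lemma bounded_ops_eqI:
  assumes A: "A \<in> bounded_ops I" and B: "B \<in> bounded_ops I"
    and eq: "\<And>a. a \<in> I \<Longrightarrow> A (ket a) = B (ket a)"
  shows "A = B"
proof
  fix f
  show "A f = B f"
  proof (cases "f \<in> ell2 I")
    case True
    show ?thesis
    proof
      fix x
      interpret A: ell2_functional I "\<lambda>f. A f x" "opnorm A"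
        using A by (rule bounded_ops_apply_functional)
      interpret B: ell2_functional I "\<lambda>f. B f x" "opnorm B"
        using B by (rule bounded_ops_apply_functional)
      have "A.representer = B.representer"
        by (auto simp: A.representer_def B.representer_def eq)
      then show "A f x = B f x"
        using A.functional_eq[OF True] B.functional_eq[OF True] by simp
    qed
  next
    case False
    then show ?thesis
      using A B by (simp add: bounded_ops_outside)
  qed
qed

lemma
  assumes A: "A \<in> bounded_ops I" and B: "B \<in> bounded_ops I"
  shows bounded_ops_plus: "A + B \<in> bounded_ops I"
    and opnorm_plus: "opnorm (A + B) \<le> opnorm A + opnorm B"
proof -
  have le: "l2norm ((A + B) f) \<le> (opnorm A + opnorm B) * l2norm f" if f: "f \<in> ell2 I" for f
    using ell2_add(2)[OF bounded_ops_ell2[OF A f] bounded_ops_ell2[OF B f]]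
      opnorm_bound[OF A f] opnorm_bound[OF B f]
    by (simp add: distrib_right)
  show sum: "A + B \<in> bounded_ops I"
  proof (rule bounded_opsI[OF _ _ _ _ le])
    fix f g :: "'a \<Rightarrow> complex" and c
    show "f \<in> ell2 I \<Longrightarrow> (A + B) f \<in> ell2 I"
      using A B by (simp add: bounded_ops_ell2 ell2_add)
    show "f \<notin> ell2 I \<Longrightarrow> (A + B) f = 0"
      using A B by (simp add: bounded_ops_outside fun_eq_iff)
    show "f \<in> ell2 I \<Longrightarrow> (A + B) (\<lambda>x. c * f x) = (\<lambda>x. c * (A + B) f x)"
      using A B by (simp add: bounded_ops_scale fun_eq_iff distrib_left)
    show "f \<in> ell2 I \<Longrightarrow> g \<in> ell2 I \<Longrightarrow> (A + B) (f + g) = (A + B) f + (A + B) g"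
      using A B by (simp add: bounded_ops_add fun_eq_iff)
  qed
  show "opnorm (A + B) \<le> opnorm A + opnorm B"
    by (rule opnorm_le[OF sum _ le]) (simp_all add: opnorm_nonneg[OF A] opnorm_nonneg[OF B])
qed

lemma
  assumes A: "A \<in> bounded_ops I"
  shows bounded_ops_scale_op: "scale_op c A \<in> bounded_ops I"
    and opnorm_scale_op: "opnorm (scale_op c A) \<le> cmod c * opnorm A"
proof -
  have le: "l2norm (scale_op c A f) \<le> (cmod c * opnorm A) * l2norm f" if f: "f \<in> ell2 I" for f
    using ell2_scale(2)[OF bounded_ops_ell2[OF A f], of c]
      mult_left_mono[OF opnorm_bound[OF A f], of "cmod c"]
    by (simp add: scale_op_def mult.assoc)
  show sc: "scale_op c A \<in> bounded_ops I"
  proof (rule bounded_opsI[OF _ _ _ _ le])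
    fix f g :: "'a \<Rightarrow> complex" and d
    show "f \<in> ell2 I \<Longrightarrow> scale_op c A f \<in> ell2 I"
      using A by (simp add: scale_op_def bounded_ops_ell2 ell2_scale)
    show "f \<notin> ell2 I \<Longrightarrow> scale_op c A f = 0"
      using A by (simp add: scale_op_def bounded_ops_outside fun_eq_iff)
    show "f \<in> ell2 I \<Longrightarrow> scale_op c A (\<lambda>x. d * f x) = (\<lambda>x. d * scale_op c A f x)"
      using A by (simp add: scale_op_def bounded_ops_scale fun_eq_iff)
    show "f \<in> ell2 I \<Longrightarrow> g \<in> ell2 I \<Longrightarrow>
        scale_op c A (f + g) = scale_op c A f + scale_op c A g"
      using A by (simp add: scale_op_def bounded_ops_add fun_eq_iff distrib_left)
  qed
  show "opnorm (scale_op c A) \<le> cmod c * opnorm A"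
    by (rule opnorm_le[OF sc _ le]) (simp_all add: opnorm_nonneg[OF A])
qed

lemma
  assumes A: "A \<in> bounded_ops I" and B: "B \<in> bounded_ops I"
  shows bounded_ops_comp: "A \<circ> B \<in> bounded_ops I"
    and opnorm_comp: "opnorm (A \<circ> B) \<le> opnorm A * opnorm B"
proof -
  have le: "l2norm ((A \<circ> B) f) \<le> (opnorm A * opnorm B) * l2norm f" if f: "f \<in> ell2 I" for f
    using opnorm_bound[OF A bounded_ops_ell2[OF B f]]
      mult_left_mono[OF opnorm_bound[OF B f] opnorm_nonneg[OF A]]
    by (simp add: mult.assoc)
  show comp: "A \<circ> B \<in> bounded_ops I"
  proof (rule bounded_opsI[OF _ _ _ _ le])
    fix f g :: "'a \<Rightarrow> complex" and c
    show "f \<in> ell2 I \<Longrightarrow> (A \<circ> B) f \<in> ell2 I"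
      using A B by (simp add: bounded_ops_ell2)
    show "f \<notin> ell2 I \<Longrightarrow> (A \<circ> B) f = 0"
      by (simp only: o_apply bounded_ops_outside[OF B] bounded_ops_zero[OF A] not_False_eq_True)
    show "f \<in> ell2 I \<Longrightarrow> (A \<circ> B) (\<lambda>x. c * f x) = (\<lambda>x. c * (A \<circ> B) f x)"
      using A B by (simp add: bounded_ops_scale bounded_ops_ell2)
    show "f \<in> ell2 I \<Longrightarrow> g \<in> ell2 I \<Longrightarrow> (A \<circ> B) (f + g) = (A \<circ> B) f + (A \<circ> B) g"
      using A B by (simp only: o_apply bounded_ops_add bounded_ops_ell2)
  qed
  show "opnorm (A \<circ> B) \<le> opnorm A * opnorm B"
    by (rule opnorm_le[OF comp _ le]) (simp_all add: opnorm_nonneg[OF A] opnorm_nonneg[OF B])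
qed

lemma bounded_ops_0: "0 \<in> bounded_ops I"
  by (rule bounded_opsI[where K = 0]) (auto simp: fun_eq_iff)

lemma bounded_ops_id: "id_op I \<in> bounded_ops I"
proof (rule bounded_opsI[where K = 1])
  fix f g :: "'a \<Rightarrow> complex" and c
  assume f: "f \<in> ell2 I"
  show "id_op I (\<lambda>x. c * f x) = (\<lambda>x. c * id_op I f x)"
    using f by (simp add: id_op_def ell2_scale)
  assume g: "g \<in> ell2 I"
  show "id_op I (f + g) = id_op I f + id_op I g"
    using f g ell2_add(1)[OF f g] by (simp only: id_op_def if_True)
qed (simp_all add: id_op_def)

lemma oper_diff_eq: "A - B = A + scale_op (- 1) B"
  by (simp add: fun_eq_iff scale_op_def)

lemma bounded_ops_diff:
  assumes "A \<in> bounded_ops I" "B \<in> bounded_ops I"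
  shows "A - B \<in> bounded_ops I"
  unfolding oper_diff_eq using assms by (intro bounded_ops_plus bounded_ops_scale_op)

lemma bounded_ops_diff_apply:
  assumes A: "A \<in> bounded_ops I" and fg: "f \<in> ell2 I" "g \<in> ell2 I"
  shows "A (f - g) = A f - A g"
proof -
  have eq: "f - g = f + (\<lambda>x. - 1 * g x)"
    by auto
  have "A (f + (\<lambda>x. - 1 * g x)) = A f + (\<lambda>x. - 1 * A g x)"
    by (simp only: bounded_ops_add[OF A fg(1) ell2_scale(1)[OF fg(2)]] bounded_ops_scale[OF A fg(2)])
  then show ?thesis
    unfolding eq by (simp add: fun_eq_iff)
qed

section \<open>Adjoints\<close>

lemma adj_exists:
  assumes A: "A \<in> bounded_ops I"
  shows "\<exists>B \<in> bounded_ops I. (\<forall>f\<in>ell2 I. \<forall>g\<in>ell2 I. l2inner (A f) g = l2inner f (B g)) \<and>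
    opnorm B \<le> opnorm A"
proof -
  \<comment> \<open>This is the representer of \<open>\<lambda>f. l2inner g (A f)\<close>, with the
    conjugation absorbed by exchanging the arguments. Cauchy-Schwarz bounds that functional by
    \<open>opnorm A * l2norm g\<close>, so the norm of the representer also gives
    \<open>opnorm B \<le> opnorm A\<close>.\<close>
  define B :: "'a oper" where
    "B g = (if g \<in> ell2 I then (\<lambda>x. if x \<in> I then l2inner (A (ket x)) g else 0) else 0)" for g
  have *: "B g \<in> ell2 I \<and> l2norm (B g) \<le> opnorm A * l2norm g \<and>
      (\<forall>f\<in>ell2 I. l2inner (A f) g = l2inner f (B g))" if g: "g \<in> ell2 I" for g
  proof -
    interpret ell2_functional I "\<lambda>f. l2inner g (A f)" "opnorm A * l2norm g"
    proof
      fix f h :: "'a \<Rightarrow> complex" and c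
      assume f: "f \<in> ell2 I"
      note Af = bounded_ops_ell2[OF A f]
      show "l2inner g (A (\<lambda>x. c * f x)) = c * l2inner g (A f)"
        unfolding bounded_ops_scale[OF A f] using g Af by (rule l2inner_scale_right)
      show "cmod (l2inner g (A f)) \<le> opnorm A * l2norm g * l2norm f"
        using Cauchy_Schwarz_l2[OF g Af] mult_left_mono[OF opnorm_bound[OF A f], of "l2norm g"]
        by (simp add: mult_ac)
      assume h: "h \<in> ell2 I"
      show "l2inner g (A (f + h)) = l2inner g (A f) + l2inner g (A h)"
        unfolding bounded_ops_add[OF A f h]
        using g Af bounded_ops_ell2[OF A h] by (rule l2inner_add_right)
    qed (simp add: opnorm_nonneg[OF A])
    have B: "B g = representer"
      using g by (auto simp: B_def representer_def l2inner_cnj)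
    have "l2inner (A f) g = l2inner f (B g)" if "f \<in> ell2 I" for f
      using functional_eq[OF that] by (metis B l2inner_cnj)
    then show ?thesis
      using representer_ell2 l2norm_representer by (simp add: B)
  qed
  have Bb: "B \<in> bounded_ops I"
  proof (rule bounded_opsI[where K = "opnorm A"])
    fix f g :: "'a \<Rightarrow> complex" and c
    assume f: "f \<in> ell2 I"
    show "B (\<lambda>x. c * f x) = (\<lambda>x. c * B f x)"
      using f bounded_ops_ell2[OF A]
      by (auto simp: B_def ell2_scale fun_eq_iff l2inner_scale_right[of _ I])
    assume g: "g \<in> ell2 I"
    have fg: "f + g \<in> ell2 I"
      using f g by (rule ell2_add)
    show "B (f + g) = B f + B g"
    proof
      fix x
      show "B (f + g) x = (B f + B g) x"
      proof (cases "x \<in> I")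
        case True
        have "l2inner (A (ket x)) (f + g) = l2inner (A (ket x)) f + l2inner (A (ket x)) g"
          using bounded_ops_ell2[OF A ket_ell2[OF True]] f g by (rule l2inner_add_right)
        then show ?thesis
          by (simp only: B_def plus_fun_apply f g fg True if_True)
      qed (simp only: B_def plus_fun_apply f g fg if_True if_False add_0_left)
    qed
  qed (use * in \<open>auto simp: B_def\<close>)
  moreover have "opnorm B \<le> opnorm A"
    using * by (intro opnorm_le[OF Bb opnorm_nonneg[OF A]]) auto
  ultimately show ?thesis
    using * by blast
qed

lemma adj_op_eqI:
  assumes A: "A \<in> bounded_ops I" and B: "B \<in> bounded_ops I"
    and adj: "\<And>f g. f \<in> ell2 I \<Longrightarrow> g \<in> ell2 I \<Longrightarrow> l2inner (A f) g = l2inner f (B g)"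
  shows "adj_op I A = B"
  unfolding adj_op_def
proof (rule the_equality)
  fix C
  assume C: "C \<in> bounded_ops I \<and> (\<forall>f\<in>ell2 I. \<forall>g\<in>ell2 I. l2inner (A f) g = l2inner f (C g))"
  show "C = B"
  proof (rule bounded_ops_eqI[of _ I])
    fix a assume a: "a \<in> I"
    show "C (ket a) = B (ket a)"
    proof
      fix x
      show "C (ket a) x = B (ket a) x"
      proof (cases "x \<in> I")
        case True
        then have "l2inner (ket x) (C (ket a)) = l2inner (ket x) (B (ket a))"
          using C a adj by (metis ket_ell2)
        then show ?thesis
          by simp
      next
        case False
        then show ?thesis
          using B C by (metis bounded_ops_apply_outside)
      qed
    qed
  qed (use B C in auto)
qed (use B adj in auto)

lemma
  assumes A: "A \<in> bounded_ops I"
  shows bounded_ops_adj: "adj_op I A \<in> bounded_ops I"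
    and adj_op_inner: "\<And>f g. f \<in> ell2 I \<Longrightarrow> g \<in> ell2 I \<Longrightarrow> l2inner (A f) g = l2inner f (adj_op I A g)"
    and opnorm_adj: "opnorm (adj_op I A) \<le> opnorm A"
proof -
  obtain B where B: "B \<in> bounded_ops I" "\<forall>f\<in>ell2 I. \<forall>g\<in>ell2 I. l2inner (A f) g = l2inner f (B g)"
    "opnorm B \<le> opnorm A"
    using adj_exists[OF A] by blast
  moreover have "adj_op I A = B"
    using B by (intro adj_op_eqI[OF A]) auto
  ultimately show "adj_op I A \<in> bounded_ops I" "opnorm (adj_op I A) \<le> opnorm A"
    and "\<And>f g. f \<in> ell2 I \<Longrightarrow> g \<in> ell2 I \<Longrightarrow> l2inner (A f) g = l2inner f (adj_op I A g)"
    by auto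
qed

lemma adj_op_ket:
  assumes "A \<in> bounded_ops I" "a \<in> I" "b \<in> I"
  shows "adj_op I A (ket a) b = cnj (A (ket b) a)"
  using adj_op_inner[OF assms(1), of "ket b" "ket a"] assms(2,3) by simp

text \<open>Bounded operators are determined by their entries, so it suffices to recognise the
  conjugate transpose. Most adjoint laws below become identities between matrix entries in this
  way.\<close>

lemma adj_op_eqI_ket:
  assumes A: "A \<in> bounded_ops I" and B: "B \<in> bounded_ops I"
    and "\<And>a b. a \<in> I \<Longrightarrow> b \<in> I \<Longrightarrow> B (ket a) b = cnj (A (ket b) a)"
  shows "adj_op I A = B"
proof (rule bounded_ops_eqI[OF bounded_ops_adj[OF A] B])
  fix a assume a: "a \<in> I"
  show "adj_op I A (ket a) = B (ket a)"
  proof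
    fix x
    show "adj_op I A (ket a) x = B (ket a) x"
      using assms a adj_op_ket[OF A a] bounded_ops_adj[OF A]
      by (cases "x \<in> I") (auto simp: bounded_ops_apply_outside)
  qed
qed

lemma adj_op_plus:
  assumes A: "A \<in> bounded_ops I" and B: "B \<in> bounded_ops I"
  shows "adj_op I (A + B) = adj_op I A + adj_op I B"
  by (rule adj_op_eqI_ket[OF bounded_ops_plus[OF A B]])
    (use A B in \<open>auto simp: bounded_ops_plus bounded_ops_adj adj_op_ket\<close>)

lemma adj_op_scale_op:
  assumes A: "A \<in> bounded_ops I"
  shows "adj_op I (scale_op c A) = scale_op (cnj c) (adj_op I A)"
  by (rule adj_op_eqI_ket[OF bounded_ops_scale_op[OF A]])
    (use A in \<open>auto simp: bounded_ops_scale_op bounded_ops_adj\<close>,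
     use A in \<open>auto simp: adj_op_ket scale_op_def\<close>)

lemma adj_op_diff:
  assumes A: "A \<in> bounded_ops I" and B: "B \<in> bounded_ops I"
  shows "adj_op I (A - B) = adj_op I A - adj_op I B"
  unfolding oper_diff_eq
  using A B by (simp only: adj_op_plus bounded_ops_scale_op adj_op_scale_op) simp

lemma adj_op_adj_op:
  assumes "A \<in> bounded_ops I"
  shows "adj_op I (adj_op I A) = A"
  by (rule adj_op_eqI_ket) (use assms in \<open>auto simp: bounded_ops_adj adj_op_ket\<close>)

lemma adj_op_comp:
  assumes A: "A \<in> bounded_ops I" and B: "B \<in> bounded_ops I"
  shows "adj_op I (A \<circ> B) = adj_op I B \<circ> adj_op I A"
  by (rule adj_op_eqI)
    (use A B in \<open>auto simp: bounded_ops_adj bounded_ops_comp adj_op_inner bounded_ops_ell2\<close>)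

lemma adj_op_0: "adj_op I 0 = 0"
  by (rule adj_op_eqI_ket) (auto simp: bounded_ops_0)

lemma cstar_gen_bounded:
  assumes "G \<subseteq> bounded_ops I" "A \<in> cstar_gen I G"
  shows "A \<in> bounded_ops I"
  using assms(2)
  by induction (use assms(1) in \<open>blast intro: bounded_ops_plus bounded_ops_scale_op
    bounded_ops_comp bounded_ops_adj\<close>)+

section \<open>Convergence in operator norm\<close>

text \<open>A coordinate of a vector is at most its norm, so the entry of \<open>X n - A\<close> is
  controlled by \<open>opnorm (X n - A)\<close>. All later limit arguments about \<Delta> and about
  morphisms are carried out on such entries.\<close>

lemma op_tendsto_apply:
  assumes X: "\<And>n. X n \<in> bounded_ops I" and A: "A \<in> bounded_ops I"
    and f: "f \<in> ell2 I" and lim: "op_tendsto X A"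
  shows "(\<lambda>n. X n f x) \<longlonglongrightarrow> A f x"
proof -
  have le: "norm (X n f x - A f x) \<le> norm (opnorm (X n - A)) * l2norm f" for n
  proof -
    have D: "X n - A \<in> bounded_ops I"
      using X A by (rule bounded_ops_diff)
    have "norm ((X n - A) f x) \<le> opnorm (X n - A) * l2norm f"
      using norm_le_l2norm[OF bounded_ops_ell2[OF D f]] opnorm_bound[OF D f] by (rule order_trans)
    then show ?thesis
      by (simp add: opnorm_nonneg[OF D])
  qed
  have "(\<lambda>n. X n f x - A f x) \<longlonglongrightarrow> 0"
    by (rule tendsto_0_le[OF lim[unfolded op_tendsto_def], where K = "l2norm f"])
      (simp add: le del: real_norm_def)
  then show ?thesis
    by (rule LIM_zero_cancel)
qed

lemma op_tendstoI:
  assumes X: "\<And>n. X n \<in> bounded_ops I" and A: "A \<in> bounded_ops I"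
    and r: "r \<longlonglongrightarrow> 0" and le: "\<And>n. opnorm (X n - A) \<le> r n"
  shows "op_tendsto X A"
  unfolding op_tendsto_def
  by (rule tendsto_sandwich[OF _ _ tendsto_const r])
    (auto simp: le opnorm_nonneg[OF bounded_ops_diff[OF X A]])

lemma op_tendsto_plus:
  assumes X: "\<And>n. X n \<in> bounded_ops I" and A: "A \<in> bounded_ops I" and XA: "op_tendsto X A"
    and Y: "\<And>n. Y n \<in> bounded_ops I" and B: "B \<in> bounded_ops I" and YB: "op_tendsto Y B"
  shows "op_tendsto (\<lambda>n. X n + Y n) (A + B)"
proof (rule op_tendstoI)
  show "(\<lambda>n. opnorm (X n - A) + opnorm (Y n - B)) \<longlonglongrightarrow> 0"
    using tendsto_add[OF XA[unfolded op_tendsto_def] YB[unfolded op_tendsto_def]] by simp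
  fix n
  have "(X n + Y n) - (A + B) = (X n - A) + (Y n - B)"
    by (simp add: fun_eq_iff)
  then show "opnorm ((X n + Y n) - (A + B)) \<le> opnorm (X n - A) + opnorm (Y n - B)"
    using opnorm_plus[OF bounded_ops_diff[OF X A] bounded_ops_diff[OF Y B]] by (simp only:)
qed (use assms in \<open>auto intro: bounded_ops_plus\<close>)

lemma op_tendsto_scale_op:
  assumes X: "\<And>n. X n \<in> bounded_ops I" and A: "A \<in> bounded_ops I" and XA: "op_tendsto X A"
  shows "op_tendsto (\<lambda>n. scale_op c (X n)) (scale_op c A)"
proof (rule op_tendstoI)
  show "(\<lambda>n. cmod c * opnorm (X n - A)) \<longlonglongrightarrow> 0"
    using XA by (auto simp: op_tendsto_def intro: tendsto_mult_right_zero)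
  fix n
  have "scale_op c (X n) - scale_op c A = scale_op c (X n - A)"
    by (simp add: fun_eq_iff scale_op_def right_diff_distrib)
  then show "opnorm (scale_op c (X n) - scale_op c A) \<le> cmod c * opnorm (X n - A)"
    using opnorm_scale_op[OF bounded_ops_diff[OF X A], of c n] by (simp only:)
qed (use assms in \<open>auto intro: bounded_ops_scale_op\<close>)

lemma op_tendsto_adj:
  assumes X: "\<And>n. X n \<in> bounded_ops I" and A: "A \<in> bounded_ops I" and XA: "op_tendsto X A"
  shows "op_tendsto (\<lambda>n. adj_op I (X n)) (adj_op I A)"
proof (rule op_tendstoI)
  show "(\<lambda>n. opnorm (X n - A)) \<longlonglongrightarrow> 0"
    using XA by (simp add: op_tendsto_def)
  show "opnorm (adj_op I (X n) - adj_op I A) \<le> opnorm (X n - A)" for n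
    using opnorm_adj[OF bounded_ops_diff[OF X A], of n] by (simp only: adj_op_diff[OF X A])
qed (use assms in \<open>auto intro: bounded_ops_adj\<close>)

text \<open>The difference splits as (X - A) Y + A (Y - B). The factors \<open>Y n\<close> stay
  bounded because their norm is at most \<open>opnorm (Y n - B) + opnorm B\<close>.\<close>

lemma op_tendsto_comp:
  assumes X: "\<And>n. X n \<in> bounded_ops I" and A: "A \<in> bounded_ops I" and XA: "op_tendsto X A"
    and Y: "\<And>n. Y n \<in> bounded_ops I" and B: "B \<in> bounded_ops I" and YB: "op_tendsto Y B"
  shows "op_tendsto (\<lambda>n. X n \<circ> Y n) (A \<circ> B)"
proof (rule op_tendstoI)
  let ?r = "\<lambda>n. opnorm (X n - A) * (opnorm (Y n - B) + opnorm B) + opnorm A * opnorm (Y n - B)"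
  note lims = XA[unfolded op_tendsto_def] YB[unfolded op_tendsto_def]
  have "?r \<longlonglongrightarrow> 0 * (0 + opnorm B) + opnorm A * 0"
    by (intro tendsto_intros lims)
  then show "?r \<longlonglongrightarrow> 0"
    by simp
  fix n
  note D = bounded_ops_diff[OF X A, of n] and E = bounded_ops_diff[OF Y B, of n]
  have "(X n \<circ> Y n) - (A \<circ> B) = ((X n - A) \<circ> Y n) + (A \<circ> (Y n - B))"
  proof
    fix f
    show "((X n \<circ> Y n) - (A \<circ> B)) f = (((X n - A) \<circ> Y n) + (A \<circ> (Y n - B))) f"
    proof (cases "f \<in> ell2 I")
      case True
      then show ?thesis
        by (simp only: o_apply minus_apply plus_fun_apply
            bounded_ops_diff_apply[OF A bounded_ops_ell2[OF Y True] bounded_ops_ell2[OF B True]])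
          simp
    next
      case False
      then show ?thesis
        by (simp only: o_apply minus_apply plus_fun_apply bounded_ops_zero[OF A]
            bounded_ops_zero[OF X] diff_self add_0_left
            bounded_ops_outside[OF X False] bounded_ops_outside[OF Y False]
            bounded_ops_outside[OF A False] bounded_ops_outside[OF B False])
    qed
  qed
  then have "opnorm ((X n \<circ> Y n) - (A \<circ> B)) \<le> opnorm ((X n - A) \<circ> Y n) + opnorm (A \<circ> (Y n - B))"
    using opnorm_plus[OF bounded_ops_comp[OF D Y] bounded_ops_comp[OF A E]] by (simp only:)
  moreover have "opnorm ((X n - A) \<circ> Y n) \<le> opnorm (X n - A) * opnorm (Y n)"
    by (rule opnorm_comp[OF D Y])
  moreover have "opnorm (A \<circ> (Y n - B)) \<le> opnorm A * opnorm (Y n - B)"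
    by (rule opnorm_comp[OF A E])
  moreover have "opnorm (Y n) \<le> opnorm (Y n - B) + opnorm B"
    using opnorm_plus[OF E B] by simp
  then have "opnorm (X n - A) * opnorm (Y n) \<le> opnorm (X n - A) * (opnorm (Y n - B) + opnorm B)"
    by (rule mult_left_mono) (rule opnorm_nonneg[OF D])
  ultimately show "opnorm ((X n \<circ> Y n) - (A \<circ> B)) \<le> ?r n"
    by linarith
qed (use assms in \<open>auto intro: bounded_ops_comp\<close>)

section \<open>Tensor products of operators\<close>

lemma l2norm_has_sum:
  "f \<in> ell2 I \<Longrightarrow> ((\<lambda>x. (cmod (f x))\<^sup>2) has_sum (l2norm f)\<^sup>2) UNIV"
  by (simp add: ell2_def l2norm_def infsum_nonneg)

lemma ell2_slice:
  assumes f: "f \<in> ell2 (I \<times> J)"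
  shows "(\<lambda>x. f (x, y)) \<in> ell2 I"
proof (rule ell2_bound(1))
  fix F :: "'a set" assume "finite F"
  have "(\<Sum>x\<in>F. (cmod (f (x, y)))\<^sup>2) = (\<Sum>z\<in>(\<lambda>x. (x, y)) ` F. (cmod (f z))\<^sup>2)"
    by (simp add: sum.reindex inj_on_def)
  also have "\<dots> \<le> (l2norm f)\<^sup>2"
    using \<open>finite F\<close> by (intro sum_le_l2norm[OF f]) simp
  finally show "(\<Sum>x\<in>F. (cmod (f (x, y)))\<^sup>2) \<le> (l2norm f)\<^sup>2" .
qed (use f in \<open>simp add: ell2_outside\<close>)

text \<open>With finitely many slices the sum over \<open>y\<close> can be pulled inside the
  infinite sum over \<open>x\<close>. Each finite partial sum then runs over a rectangle
  \<open>G \<times> F\<close> and is bounded by the full norm.\<close>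

lemma sum_l2norm_slices:
  assumes f: "f \<in> ell2 (I \<times> J)" and "finite F"
  shows "(\<Sum>y\<in>F. (l2norm (\<lambda>x. f (x, y)))\<^sup>2) \<le> (l2norm f)\<^sup>2"
proof (rule has_sum_le_finite_sums)
  from \<open>finite F\<close>
  show "((\<lambda>x. \<Sum>y\<in>F. (cmod (f (x, y)))\<^sup>2) has_sum (\<Sum>y\<in>F. (l2norm (\<lambda>x. f (x, y)))\<^sup>2)) UNIV"
  proof induction
    case (insert y F)
    then show ?case
      using has_sum_add[OF l2norm_has_sum[OF ell2_slice[OF f, of y]] insert.IH] by simp
  qed simp
  fix G :: "'a set" assume "finite G"
  have "(\<Sum>x\<in>G. \<Sum>y\<in>F. (cmod (f (x, y)))\<^sup>2) = (\<Sum>z\<in>G \<times> F. (cmod (f z))\<^sup>2)"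
    by (simp add: sum.cartesian_product)
  also have "\<dots> \<le> (l2norm f)\<^sup>2"
    using \<open>finite G\<close> \<open>finite F\<close> by (intro sum_le_l2norm[OF f]) simp
  finally show "(\<Sum>x\<in>G. \<Sum>y\<in>F. (cmod (f (x, y)))\<^sup>2) \<le> (l2norm f)\<^sup>2" .
qed

text \<open>A finite set of pairs lies in the rectangle of its two projections, and over a rectangle
  the sum of squares factors into a product.\<close>

lemma tensor_vec_ell2:
  assumes f: "f \<in> ell2 I" and g: "g \<in> ell2 J"
  shows "tensor_vec f g \<in> ell2 (I \<times> J)"
proof (rule ell2_bound(1))
  fix F :: "('a \<times> 'b) set" assume F: "finite F"
  let ?X = "fst ` F" and ?Y = "snd ` F"
  have "(\<Sum>z\<in>F. (cmod (tensor_vec f g z))\<^sup>2) \<le> (\<Sum>z\<in>?X \<times> ?Y. (cmod (tensor_vec f g z))\<^sup>2)"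
    using F by (intro sum_mono2 subset_fst_snd) auto
  also have "\<dots> = (\<Sum>x\<in>?X. (cmod (f x))\<^sup>2) * (\<Sum>y\<in>?Y. (cmod (g y))\<^sup>2)"
    by (simp add: sum_product sum.cartesian_product tensor_vec_def norm_mult power_mult_distrib
        case_prod_beta)
  also have "\<dots> \<le> (l2norm f)\<^sup>2 * (l2norm g)\<^sup>2"
    using F by (intro mult_mono sum_le_l2norm[OF f] sum_le_l2norm[OF g]) (auto intro: sum_nonneg)
  finally show "(\<Sum>z\<in>F. (cmod (tensor_vec f g z))\<^sup>2) \<le> (l2norm f)\<^sup>2 * (l2norm g)\<^sup>2" .
next
  fix z assume "z \<notin> I \<times> J"
  then show "tensor_vec f g z = 0"
    using ell2_outside[OF f] ell2_outside[OF g] by (cases z) (auto simp: tensor_vec_def)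
qed

text \<open>The operators \<open>A \<otimes> 1\<close> and \<open>1 \<otimes> B\<close>.\<close>

definition ampl_left :: "'a set \<Rightarrow> 'b set \<Rightarrow> 'a oper \<Rightarrow> ('a \<times> 'b) oper" where
  "ampl_left I J A f = (if f \<in> ell2 (I \<times> J) then (\<lambda>(x, y). A (\<lambda>u. f (u, y)) x) else 0)"

definition swap_vec :: "('a \<times> 'b \<Rightarrow> complex) \<Rightarrow> ('b \<times> 'a \<Rightarrow> complex)" where
  "swap_vec f = (\<lambda>(y, x). f (x, y))"

definition ampl_right :: "'a set \<Rightarrow> 'b set \<Rightarrow> 'b oper \<Rightarrow> ('a \<times> 'b) oper" where
  "ampl_right I J B f = swap_vec (ampl_left J I B (swap_vec f))"

text \<open>The operator acts on each slice with fixed second coordinate separately. The estimate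
  for \<open>A\<close> holds slice by slice with the same constant, and the squared norms of the
  slices add up to at most that of \<open>f\<close>.\<close>

lemma ampl_left_bounded:
  assumes A: "A \<in> bounded_ops I"
  shows "ampl_left I J A \<in> bounded_ops (I \<times> J)"
proof -
  have *: "ampl_left I J A f \<in> ell2 (I \<times> J) \<and>
      (l2norm (ampl_left I J A f))\<^sup>2 \<le> (opnorm A)\<^sup>2 * (l2norm f)\<^sup>2"
    if f: "f \<in> ell2 (I \<times> J)" for f
  proof -
    note slice = ell2_slice[OF f]
    have eq: "ampl_left I J A f (x, y) = A (\<lambda>u. f (u, y)) x" for x y
      using f by (simp add: ampl_left_def)
    have out: "ampl_left I J A f z = 0" if "z \<notin> I \<times> J" for z
    proof (cases z)
      case (Pair x y)
      then consider "x \<notin> I" | "y \<notin> J"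
        using \<open>z \<notin> I \<times> J\<close> by auto
      then show ?thesis
      proof cases
        case 1
        then show ?thesis
          unfolding Pair eq by (rule bounded_ops_apply_outside[OF A])
      next
        case 2
        then have "(\<lambda>u. f (u, y)) = 0"
          using ell2_outside[OF f] by auto
        then show ?thesis
          unfolding Pair eq by (simp only: bounded_ops_zero[OF A] zero_fun_apply)
      qed
    qed
    have fin: "(\<Sum>z\<in>F. (cmod (ampl_left I J A f z))\<^sup>2) \<le> (opnorm A)\<^sup>2 * (l2norm f)\<^sup>2"
      if F: "finite F" for F
    proof -
      let ?X = "fst ` F" and ?Y = "snd ` F"
      have "(\<Sum>z\<in>F. (cmod (ampl_left I J A f z))\<^sup>2)
          \<le> (\<Sum>z\<in>?X \<times> ?Y. (cmod (ampl_left I J A f z))\<^sup>2)"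
        using F by (intro sum_mono2 subset_fst_snd) auto
      also have "\<dots> = (\<Sum>x\<in>?X. \<Sum>y\<in>?Y. (cmod (ampl_left I J A f (x, y)))\<^sup>2)"
        by (simp add: sum.cartesian_product)
      also have "\<dots> = (\<Sum>y\<in>?Y. \<Sum>x\<in>?X. (cmod (A (\<lambda>u. f (u, y)) x))\<^sup>2)"
        unfolding eq by (rule sum.swap)
      also have "\<dots> \<le> (\<Sum>y\<in>?Y. (opnorm A)\<^sup>2 * (l2norm (\<lambda>u. f (u, y)))\<^sup>2)"
      proof (rule sum_mono)
        fix y
        have "(\<Sum>x\<in>?X. (cmod (A (\<lambda>u. f (u, y)) x))\<^sup>2) \<le> (l2norm (A (\<lambda>u. f (u, y))))\<^sup>2"
          using F by (intro sum_le_l2norm[OF bounded_ops_ell2[OF A slice]]) simp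
        also have "\<dots> \<le> (opnorm A * l2norm (\<lambda>u. f (u, y)))\<^sup>2"
          using opnorm_bound[OF A slice] by (simp add: power_mono)
        finally show "(\<Sum>x\<in>?X. (cmod (A (\<lambda>u. f (u, y)) x))\<^sup>2) \<le> (opnorm A)\<^sup>2 * (l2norm (\<lambda>u. f (u, y)))\<^sup>2"
          by (simp add: power_mult_distrib)
      qed
      also have "\<dots> \<le> (opnorm A)\<^sup>2 * (l2norm f)\<^sup>2"
        using F by (simp add: sum_distrib_left[symmetric] mult_left_mono sum_l2norm_slices[OF f])
      finally show ?thesis .
    qed
    show ?thesis
      using ell2_bound[OF out fin] by blast
  qed
  show ?thesis
  proof (rule bounded_opsI[where K = "opnorm A"])
    fix f g :: "'a \<times> 'b \<Rightarrow> complex" and c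
    assume f: "f \<in> ell2 (I \<times> J)"
    show "ampl_left I J A f \<in> ell2 (I \<times> J)"
      using *[OF f] by simp
    have "(l2norm (ampl_left I J A f))\<^sup>2 \<le> (opnorm A * l2norm f)\<^sup>2"
      using *[OF f] by (simp add: power_mult_distrib)
    then show "l2norm (ampl_left I J A f) \<le> opnorm A * l2norm f"
      by (rule power2_le_imp_le) (simp add: opnorm_nonneg[OF A])
    show "ampl_left I J A (\<lambda>z. c * f z) = (\<lambda>z. c * ampl_left I J A f z)"
      using f by (auto simp: ampl_left_def ell2_scale bounded_ops_scale[OF A ell2_slice])
    assume g: "g \<in> ell2 (I \<times> J)"
    have "A (\<lambda>u. f (u, y) + g (u, y)) x = A (\<lambda>u. f (u, y)) x + A (\<lambda>u. g (u, y)) x" for x y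
      using fun_cong[OF bounded_ops_add[OF A ell2_slice[OF f] ell2_slice[OF g]]]
      by (simp add: plus_fun_def)
    then show "ampl_left I J A (f + g) = ampl_left I J A f + ampl_left I J A g"
      using f g ell2_add(1)[OF f g] unfolding ampl_left_def
      by (simp only: if_True) (auto simp: fun_eq_iff)
  qed (simp add: ampl_left_def)
qed

lemma swap_swap_vec [simp]: "swap_vec (swap_vec f) = f"
  by (auto simp: swap_vec_def)

lemma
  assumes f: "f \<in> ell2 (I \<times> J)"
  shows swap_vec_ell2: "swap_vec f \<in> ell2 (J \<times> I)"
    and l2norm_swap_vec: "l2norm (swap_vec f) \<le> l2norm f"
proof -
  have out: "swap_vec f z = 0" if "z \<notin> J \<times> I" for z
    using that ell2_outside[OF f] by (auto simp: swap_vec_def split: prod.split)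
  have fin: "(\<Sum>z\<in>F. (cmod (swap_vec f z))\<^sup>2) \<le> (l2norm f)\<^sup>2" if "finite F" for F
  proof -
    have "(\<Sum>z\<in>F. (cmod (swap_vec f z))\<^sup>2) = (\<Sum>z\<in>prod.swap ` F. (cmod (f z))\<^sup>2)"
      by (subst sum.reindex) (auto simp: swap_vec_def prod.swap_def case_prod_beta)
    also have "\<dots> \<le> (l2norm f)\<^sup>2"
      using that by (intro sum_le_l2norm[OF f]) simp
    finally show ?thesis .
  qed
  show "swap_vec f \<in> ell2 (J \<times> I)"
    by (rule ell2_bound(1)[OF out fin])
  have "(l2norm (swap_vec f))\<^sup>2 \<le> (l2norm f)\<^sup>2"
    by (rule ell2_bound(2)[OF out fin])
  then show "l2norm (swap_vec f) \<le> l2norm f"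
    by (rule power2_le_imp_le) simp
qed

text \<open>Conjugation by the flip of coordinates reduces this to the left amplification, as the
  flip does not increase norms.\<close>

lemma ampl_right_bounded:
  assumes B: "B \<in> bounded_ops J"
  shows "ampl_right I J B \<in> bounded_ops (I \<times> J)"
proof (rule bounded_opsI[where K = "opnorm (ampl_left J I B)"])
  note L = ampl_left_bounded[OF B, of I]
  fix f g :: "'b \<times> 'a \<Rightarrow> complex" and c
  show "ampl_right I J B f = 0" if "f \<notin> ell2 (I \<times> J)"
  proof -
    have "swap_vec f \<notin> ell2 (J \<times> I)"
      using that swap_vec_ell2[of "swap_vec f"] by auto
    then show ?thesis
      by (auto simp: ampl_right_def ampl_left_def swap_vec_def)
  qed
  assume f: "f \<in> ell2 (I \<times> J)"
  note sf = swap_vec_ell2[OF f]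
  show "ampl_right I J B f \<in> ell2 (I \<times> J)"
    unfolding ampl_right_def by (intro swap_vec_ell2 bounded_ops_ell2[OF L] sf)
  show "l2norm (ampl_right I J B f) \<le> opnorm (ampl_left J I B) * l2norm f"
    unfolding ampl_right_def
    using l2norm_swap_vec[OF bounded_ops_ell2[OF L sf]] opnorm_bound[OF L sf]
      mult_left_mono[OF l2norm_swap_vec[OF f] opnorm_nonneg[OF L]] by linarith
  have "swap_vec (\<lambda>z. c * f z) = (\<lambda>z. c * swap_vec f z)"
    by (auto simp: swap_vec_def)
  then show "ampl_right I J B (\<lambda>z. c * f z) = (\<lambda>z. c * ampl_right I J B f z)"
    unfolding ampl_right_def by (simp only: bounded_ops_scale[OF L sf]) (auto simp: swap_vec_def)
  assume g: "g \<in> ell2 (I \<times> J)"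
  have "swap_vec (f + g) = swap_vec f + swap_vec g"
    by (auto simp: swap_vec_def)
  then show "ampl_right I J B (f + g) = ampl_right I J B f + ampl_right I J B g"
    unfolding ampl_right_def by (simp only: bounded_ops_add[OF L sf swap_vec_ell2[OF g]])
      (auto simp: swap_vec_def)
qed

lemma ampl_left_tensor_vec:
  assumes A: "A \<in> bounded_ops I" and f: "f \<in> ell2 I" and g: "g \<in> ell2 J"
  shows "ampl_left I J A (tensor_vec f g) = tensor_vec (A f) g"
proof -
  have "ampl_left I J A (tensor_vec f g) (x, y) = tensor_vec (A f) g (x, y)" for x y
  proof -
    have "(\<lambda>u. tensor_vec f g (u, y)) = (\<lambda>u. g y * f u)"
      by (simp add: tensor_vec_def mult.commute)
    then have "ampl_left I J A (tensor_vec f g) (x, y) = g y * A f x"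
      using tensor_vec_ell2[OF f g] by (simp add: ampl_left_def bounded_ops_scale[OF A f])
    then show ?thesis
      by (simp add: tensor_vec_def)
  qed
  then show ?thesis
    by auto
qed

lemma ampl_right_tensor_vec:
  assumes B: "B \<in> bounded_ops J" and f: "f \<in> ell2 I" and g: "g \<in> ell2 J"
  shows "ampl_right I J B (tensor_vec f g) = tensor_vec f (B g)"
proof -
  have swap: "swap_vec (tensor_vec h k) = tensor_vec k h" for h :: "'c \<Rightarrow> complex" and k :: "'d \<Rightarrow> complex"
    by (auto simp: swap_vec_def tensor_vec_def)
  show ?thesis
    unfolding ampl_right_def swap ampl_left_tensor_vec[OF B g f] by (rule refl)
qed

lemma tensor_vec_ket: "tensor_vec (ket a) (ket b) = ket (a, b)"
  by (auto simp: tensor_vec_def ket_def fun_eq_iff)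

text \<open>Existence: the composite of \<open>A \<otimes> 1\<close> and
  \<open>1 \<otimes> B\<close> has the required values on elementary tensors. Uniqueness: the basis
  vectors of the product space are themselves elementary tensors.\<close>

lemma
  assumes A: "A \<in> bounded_ops I" and B: "B \<in> bounded_ops J"
  shows bounded_ops_tensor: "tensor_op I J A B \<in> bounded_ops (I \<times> J)"
    and tensor_op_tensor_vec:
      "f \<in> ell2 I \<Longrightarrow> g \<in> ell2 J \<Longrightarrow> tensor_op I J A B (tensor_vec f g) = tensor_vec (A f) (B g)"
proof -
  let ?P = "\<lambda>C. C \<in> bounded_ops (I \<times> J) \<and>
    (\<forall>f\<in>ell2 I. \<forall>g\<in>ell2 J. C (tensor_vec f g) = tensor_vec (A f) (B g))"
  have P: "?P (ampl_left I J A \<circ> ampl_right I J B)"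
  proof (intro conjI ballI)
    show "ampl_left I J A \<circ> ampl_right I J B \<in> bounded_ops (I \<times> J)"
      by (intro bounded_ops_comp ampl_left_bounded ampl_right_bounded A B)
    fix f g assume f: "f \<in> ell2 I" and g: "g \<in> ell2 J"
    show "(ampl_left I J A \<circ> ampl_right I J B) (tensor_vec f g) = tensor_vec (A f) (B g)"
      by (simp only: o_apply ampl_right_tensor_vec[OF B f g]
          ampl_left_tensor_vec[OF A f bounded_ops_ell2[OF B g]])
  qed
  have unique: "C = D" if "?P C" "?P D" for C D
  proof (rule bounded_ops_eqI[of _ "I \<times> J"])
    fix z assume "z \<in> I \<times> J"
    then obtain a b where "z = (a, b)" "a \<in> I" "b \<in> J"
      by blast
    then show "C (ket z) = D (ket z)"
      using that by (simp flip: tensor_vec_ket)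
  qed (use that in auto)
  have "?P (tensor_op I J A B)"
    unfolding tensor_op_def by (rule theI[of ?P, OF P unique[OF _ P]])
  then show "tensor_op I J A B \<in> bounded_ops (I \<times> J)"
    and "f \<in> ell2 I \<Longrightarrow> g \<in> ell2 J \<Longrightarrow> tensor_op I J A B (tensor_vec f g) = tensor_vec (A f) (B g)"
    by auto
qed

lemma tensor_op_ket:
  assumes "A \<in> bounded_ops I" "B \<in> bounded_ops J" "c \<in> I" "d \<in> J"
  shows "tensor_op I J A B (ket (c, d)) (c', d') = A (ket c) c' * B (ket d) d'"
  using tensor_op_tensor_vec[OF assms(1,2), of "ket c" "ket d"] assms(3,4)
  by (simp add: tensor_vec_ket) (simp add: tensor_vec_def)

lemma min_tensor_bounded:
  assumes "\<A> \<subseteq> bounded_ops I" "\<B> \<subseteq> bounded_ops J"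
  shows "min_tensor I J \<A> \<B> \<subseteq> bounded_ops (I \<times> J)"
proof -
  have "{tensor_op I J A B | A B. A \<in> \<A> \<and> B \<in> \<B>} \<subseteq> bounded_ops (I \<times> J)"
    using assms bounded_ops_tensor by blast
  from cstar_gen_bounded[OF this] show ?thesis
    unfolding min_tensor_def by blast
qed

section \<open>Semigroup isometries\<close>

text \<open>Functions are transported along the inverse of \<open>h\<close> and extended by 0 off
  the image. Injectivity makes the sum of squares over a finite set of targets a sum over distinct
  sources, so the norm does not grow.\<close>

lemma shift_exists:
  assumes inj: "inj_on h I" and sub: "h ` I \<subseteq> I"
  shows "\<exists>A \<in> bounded_ops I. \<forall>b\<in>I. A (ket b) = ket (h b)"
proof -
  define k where "k = inv_into I h"
  define A :: "'a oper" where
    "A f = (if f \<in> ell2 I then (\<lambda>c. if c \<in> h ` I then f (k c) else 0) else 0)" for f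
  have *: "A f \<in> ell2 I \<and> (l2norm (A f))\<^sup>2 \<le> (l2norm f)\<^sup>2" if f: "f \<in> ell2 I" for f
  proof -
    have out: "A f c = 0" if "c \<notin> I" for c
      using that sub f by (auto simp: A_def)
    have fin: "(\<Sum>c\<in>F. (cmod (A f c))\<^sup>2) \<le> (l2norm f)\<^sup>2" if F: "finite F" for F
    proof -
      have "(\<Sum>c\<in>F. (cmod (A f c))\<^sup>2) = (\<Sum>c\<in>F \<inter> h ` I. (cmod (f (k c)))\<^sup>2)"
        using F f by (intro sum.mono_neutral_cong_right) (auto simp: A_def)
      also have "\<dots> = (\<Sum>b\<in>k ` (F \<inter> h ` I). (cmod (f b))\<^sup>2)"
        unfolding k_def by (subst sum.reindex) (auto intro: inj_on_inv_into)
      also have "\<dots> \<le> (l2norm f)\<^sup>2"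
        using F by (intro sum_le_l2norm[OF f]) simp
      finally show ?thesis .
    qed
    show ?thesis
      using ell2_bound[OF out fin] by blast
  qed
  have "A \<in> bounded_ops I"
  proof (rule bounded_opsI[where K = 1])
    fix f g :: "'a \<Rightarrow> complex" and c
    assume f: "f \<in> ell2 I"
    show "A f \<in> ell2 I"
      using *[OF f] by simp
    show "l2norm (A f) \<le> 1 * l2norm f"
      using *[OF f] by (auto intro: power2_le_imp_le)
    show "A (\<lambda>x. c * f x) = (\<lambda>x. c * A f x)"
      using f by (auto simp: A_def ell2_scale)
    assume g: "g \<in> ell2 I"
    show "A (f + g) = A f + A g"
      using f g ell2_add(1)[OF f g] unfolding A_def by (simp only: if_True) (auto simp: fun_eq_iff)
  qed (simp add: A_def)
  moreover have "A (ket b) = ket (h b)" if b: "b \<in> I" for b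
  proof
    fix c
    have "A (ket b) c = (if c \<in> h ` I then ket b (k c) else 0)"
      using b by (simp add: A_def)
    also have "\<dots> = ket (h b) c"
      using b inj by (auto simp: k_def ket_def)
    finally show "A (ket b) c = ket (h b) c" .
  qed
  ultimately show ?thesis
    by blast
qed

locale cancellative_monoid = comm_monoid S for S :: "'a monoid" (structure) +
  assumes cancel_left:
    "\<lbrakk>a \<in> carrier S; b \<in> carrier S; c \<in> carrier S; a \<otimes> b = a \<otimes> c\<rbrakk> \<Longrightarrow> b = c"
begin

lemma T_op_exists:
  assumes "a \<in> carrier S"
  shows "\<exists>A \<in> bounded_ops (carrier S). \<forall>b\<in>carrier S. A (ket b) = ket (a \<otimes> b)"
  using assms by (intro shift_exists) (auto intro: inj_onI cancel_left)

lemma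
  assumes a: "a \<in> carrier S"
  shows T_op_bounded: "T_op S a \<in> bounded_ops (carrier S)"
    and T_op_ket: "b \<in> carrier S \<Longrightarrow> T_op S a (ket b) = ket (a \<otimes> b)"
proof -
  let ?P = "\<lambda>A. A \<in> bounded_ops (carrier S) \<and> (\<forall>b\<in>carrier S. A (ket b) = ket (a \<otimes> b))"
  obtain A where P: "?P A"
    using T_op_exists[OF a] by blast
  have unique: "B = C" if "?P B" "?P C" for B C
    using that by (intro bounded_ops_eqI[of _ "carrier S"]) auto
  have "?P (T_op S a)"
    unfolding T_op_def by (rule theI[of ?P, OF P unique[OF _ P]])
  then show "T_op S a \<in> bounded_ops (carrier S)" "b \<in> carrier S \<Longrightarrow> T_op S a (ket b) = ket (a \<otimes> b)"
    by auto
qed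

lemma T_op_eqI:
  assumes "A \<in> bounded_ops (carrier S)" "a \<in> carrier S"
    and "\<And>b. b \<in> carrier S \<Longrightarrow> A (ket b) = ket (a \<otimes> b)"
  shows "A = T_op S a"
  using assms by (intro bounded_ops_eqI[OF _ T_op_bounded]) (auto simp: T_op_ket)

lemma T_op_one: "T_op S \<one> = id_op (carrier S)"
  by (rule T_op_eqI[symmetric]) (simp_all add: bounded_ops_id, simp add: id_op_def)

lemma T_op_mult:
  assumes "a \<in> carrier S" "b \<in> carrier S"
  shows "T_op S (a \<otimes> b) = T_op S a \<circ> T_op S b"
  using assms by (intro T_op_eqI[symmetric] bounded_ops_comp T_op_bounded) (auto simp: T_op_ket m_assoc)

lemma T_op_inj:
  assumes "a \<in> carrier S" "b \<in> carrier S" "T_op S a = T_op S b"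
  shows "a = b"
proof -
  have "ket (a \<otimes> \<one>) = ket (b \<otimes> \<one>)"
    using assms by (metis T_op_ket one_closed)
  then show ?thesis
    using assms by simp
qed

lemma T_adj_bounded: "a \<in> carrier S \<Longrightarrow> T_adj S a \<in> bounded_ops (carrier S)"
  unfolding T_adj_def by (intro bounded_ops_adj T_op_bounded)

lemma T_adj_ket:
  assumes "a \<in> carrier S" "b \<in> carrier S" "c \<in> carrier S"
  shows "T_adj S a (ket c) b = (if c = a \<otimes> b then 1 else 0)"
proof -
  have "T_adj S a (ket c) b = cnj (ket (a \<otimes> b) c)"
    using assms adj_op_ket[OF T_op_bounded] by (simp add: T_adj_def T_op_ket)
  then show ?thesis
    by (simp add: ket_def)
qed

lemma T_adj_comp_T_op:
  assumes "a \<in> carrier S"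
  shows "T_adj S a \<circ> T_op S a = id_op (carrier S)"
proof (rule bounded_ops_eqI)
  show "T_adj S a \<circ> T_op S a \<in> bounded_ops (carrier S)"
    using assms by (intro bounded_ops_comp T_adj_bounded T_op_bounded)
  fix b assume b: "b \<in> carrier S"
  have "T_adj S a (ket (a \<otimes> b)) x = ket b x" for x
  proof (cases "x \<in> carrier S")
    case True
    then show ?thesis
      using assms b T_adj_ket[of a x "a \<otimes> b"] by (auto simp: ket_def dest: cancel_left)
  next
    case False
    then show ?thesis
      using assms b bounded_ops_apply_outside[OF T_adj_bounded] by (auto simp: ket_def)
  qed
  then show "(T_adj S a \<circ> T_op S a) (ket b) = id_op (carrier S) (ket b)"
    using assms b by (auto simp: T_op_ket id_op_def)
qed (rule bounded_ops_id)

end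

section \<open>Approximation by monomials\<close>

lemma sum_fun_apply2: "(\<Sum>i\<in>F. g i) f x = (\<Sum>i\<in>F. g i f x)"
  for g :: "'i \<Rightarrow> 'b \<Rightarrow> 'c \<Rightarrow> 'd::comm_monoid_add"
  by (induction F rule: infinite_finite_induct) auto

lemma opnorm_zero: "opnorm (0 :: 'a oper) = 0"
proof (rule antisym)
  show "opnorm (0 :: 'a oper) \<le> 0"
    by (rule opnorm_le[OF bounded_ops_0[of UNIV]]) simp_all
  show "0 \<le> opnorm (0 :: 'a oper)"
    by (rule opnorm_nonneg[OF bounded_ops_0[of UNIV]])
qed

text \<open>In contrast to \<open>plus_comp\<close>, which is pointwise, this uses the linearity of
  \<open>A\<close> on \<open>ell2 I\<close>; off \<open>ell2 I\<close> it amounts to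
  \<open>A 0 = 0\<close>.\<close>

lemma comp_plus_right:
  assumes A: "A \<in> bounded_ops I" and B: "B \<in> bounded_ops I" and C: "C \<in> bounded_ops I"
  shows "A \<circ> (B + C) = (A \<circ> B) + (A \<circ> C)"
proof
  fix f
  show "(A \<circ> (B + C)) f = ((A \<circ> B) + (A \<circ> C)) f"
  proof (cases "f \<in> ell2 I")
    case True
    then show ?thesis
      by (simp only: o_apply plus_fun_apply bounded_ops_add[OF A] bounded_ops_ell2[OF B]
          bounded_ops_ell2[OF C])
  next
    case False
    then show ?thesis
      by (simp only: o_apply plus_fun_apply add_0_left bounded_ops_outside[OF B False]
          bounded_ops_outside[OF C False] bounded_ops_zero[OF A])
  qed
qed

lemma comp_scale_op_right:
  assumes A: "A \<in> bounded_ops I" and B: "B \<in> bounded_ops I"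
  shows "A \<circ> scale_op c B = scale_op c (A \<circ> B)"
proof
  fix f
  show "(A \<circ> scale_op c B) f = scale_op c (A \<circ> B) f"
  proof (cases "f \<in> ell2 I")
    case True
    then show ?thesis
      by (simp only: o_apply scale_op_def bounded_ops_scale[OF A] bounded_ops_ell2[OF B])
  next
    case False
    have "(\<lambda>x. c * (0 :: 'a \<Rightarrow> complex) x) = 0"
      by auto
    then show ?thesis
      by (simp only: o_apply scale_op_def bounded_ops_outside[OF B False] bounded_ops_zero[OF A])
  qed
qed

lemma plus_comp: "(A + B) \<circ> C = (A \<circ> C) + (B \<circ> C)" for A B :: "'a oper"
  by (simp add: fun_eq_iff)

lemma scale_op_comp: "scale_op c A \<circ> C = scale_op c (A \<circ> C)"
  by (simp add: fun_eq_iff scale_op_def)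

lemma scale_op_plus: "scale_op c (A + B) = scale_op c A + scale_op c B"
  by (simp add: fun_eq_iff scale_op_def distrib_left)

lemma scale_op_scale_op: "scale_op c (scale_op d A) = scale_op (c * d) A"
  by (simp add: fun_eq_iff scale_op_def mult.assoc)

lemma scale_op_zero: "scale_op c 0 = 0" "scale_op 0 A = 0"
  by (simp_all add: fun_eq_iff scale_op_def)

lemma scale_op_one [simp]: "scale_op 1 A = A"
  by (simp add: scale_op_def)

text \<open>Appending one scaled monomial at a time suits the inductions for closure under sums,
  products and adjoints. The lemma \<open>monomial_span_sum\<close> converts to the indexed sums on
  which \<open>is_comult\<close> prescribes \<Delta>.\<close>

inductive_set monomial_span :: "'a monoid \<Rightarrow> 'a oper set" for S :: "'a monoid" where
  zero: "0 \<in> monomial_span S"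
| step: "\<lbrakk>x \<in> monomial_span S; V \<in> monomials S\<rbrakk> \<Longrightarrow> x + scale_op c V \<in> monomial_span S"

lemma monomial_span_sum:
  "x \<in> monomial_span S \<Longrightarrow>
    \<exists>(n::nat) c V. (\<forall>i<n. V i \<in> monomials S) \<and> x = (\<Sum>i<n. scale_op (c i) (V i))"
proof (induction rule: monomial_span.induct)
  case zero
  show ?case
    by (rule exI[of _ 0]) simp
next
  case (step x W d)
  then obtain n :: nat and c V where V: "\<And>i. i < n \<Longrightarrow> V i \<in> monomials S"
    and x: "x = (\<Sum>i<n. scale_op (c i) (V i))"
    by blast
  let ?c = "c(n := d)" and ?V = "V(n := W)"
  have "x + scale_op d W = (\<Sum>i<Suc n. scale_op (?c i) (?V i))"
    unfolding x by simp
  moreover have "\<forall>i<Suc n. ?V i \<in> monomials S"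
    using V step.hyps(2) by (simp add: less_Suc_eq)
  ultimately show ?case
    by blast
qed

lemma monomial_span_plus:
  assumes x: "x \<in> monomial_span S" and y: "y \<in> monomial_span S"
  shows "x + y \<in> monomial_span S"
  using y
proof induction
  case zero
  show ?case
    using x by (simp only: add_0_right)
next
  case (step y V c)
  then show ?case
    by (metis add.assoc monomial_span.step)
qed

lemma monomial_span_scale:
  "x \<in> monomial_span S \<Longrightarrow> scale_op c x \<in> monomial_span S"
proof (induction rule: monomial_span.induct)
  case (step x V d)
  then show ?case
    by (simp only: scale_op_plus scale_op_scale_op) (rule monomial_span.step)
qed (simp only: scale_op_zero monomial_span.zero)

lemma monomial_in_span: "V \<in> monomials S \<Longrightarrow> V \<in> monomial_span S"
  using monomial_span.step[OF monomial_span.zero, of V S 1] by (simp only: add_0_left scale_op_one)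

context cancellative_monoid
begin

lemma monomials_bounded: "V \<in> monomials S \<Longrightarrow> V \<in> bounded_ops (carrier S)"
  by (induction rule: monomials.induct) (blast intro: T_op_bounded T_adj_bounded bounded_ops_comp)+

lemma monomials_adj: "V \<in> monomials S \<Longrightarrow> adj_op (carrier S) V \<in> monomials S"
proof (induction rule: monomials.induct)
  case (shift a)
  then show ?case
    using monomials.shift_adj[of a S] by (simp only: T_adj_def)
next
  case (shift_adj a)
  then show ?case
    using monomials.shift[of a S] by (simp only: T_adj_def adj_op_adj_op[OF T_op_bounded])
next
  case (prod V W)
  then show ?case
    by (simp only: adj_op_comp[OF monomials_bounded monomials_bounded]) (rule monomials.prod)
qed

lemma monomial_span_bounded: "x \<in> monomial_span S \<Longrightarrow> x \<in> bounded_ops (carrier S)"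
  by (induction rule: monomial_span.induct)
    (blast intro: bounded_ops_0 bounded_ops_plus bounded_ops_scale_op monomials_bounded)+

text \<open>Products are expanded one factor at a time: \<open>mono\<close> handles a single
  monomial on the right by induction on \<open>x\<close>, and the induction on \<open>y\<close> then
  distributes the linear operator \<open>x\<close>.\<close>

lemma monomial_span_comp:
  assumes x: "x \<in> monomial_span S" and y: "y \<in> monomial_span S"
  shows "x \<circ> y \<in> monomial_span S"
proof -
  have mono: "x \<circ> V \<in> monomial_span S" if V: "V \<in> monomials S" for V
    using x
  proof induction
    case zero
    have "(0 :: 'a oper) \<circ> V = 0"
      by (simp add: fun_eq_iff)
    then show ?case
      by (simp only: monomial_span.zero)
  next
    case (step x W c)
    then show ?case
      unfolding plus_comp scale_op_comp by (intro monomial_span.step monomials.prod V)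
  qed
  note xb = monomial_span_bounded[OF x]
  show ?thesis
    using y
  proof induction
    case zero
    have "x \<circ> 0 = (0 :: 'a oper)"
      by (rule ext) (simp only: o_apply zero_fun_apply bounded_ops_zero[OF xb])
    then show ?case
      by (simp only: monomial_span.zero)
  next
    case (step y V c)
    note Vb = monomials_bounded[OF step.hyps(2)]
    have "x \<circ> (y + scale_op c V) = (x \<circ> y) + scale_op c (x \<circ> V)"
      by (simp only: comp_plus_right[OF xb monomial_span_bounded[OF step.hyps(1)] bounded_ops_scale_op[OF Vb]]
          comp_scale_op_right[OF xb Vb])
    then show ?case
      using step.IH mono[OF step.hyps(2)] by (simp only: monomial_span_plus monomial_span_scale)
  qed
qed

lemma monomial_span_adj:
  "x \<in> monomial_span S \<Longrightarrow> adj_op (carrier S) x \<in> monomial_span S"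
proof (induction rule: monomial_span.induct)
  case zero
  show ?case
    by (simp only: adj_op_0 monomial_span.zero)
next
  case (step x V c)
  note Vb = monomials_bounded[OF step.hyps(2)]
  show ?case
    unfolding adj_op_plus[OF monomial_span_bounded[OF step.hyps(1)] bounded_ops_scale_op[OF Vb]]
      adj_op_scale_op[OF Vb]
    by (intro monomial_span.step step.IH monomials_adj step.hyps(2))
qed

lemma T_op_in_C_red: "a \<in> carrier S \<Longrightarrow> T_op S a \<in> C_red S"
  unfolding C_red_def by (rule cstar_gen.gen) blast

lemma C_red_bounded: "C_red S \<subseteq> bounded_ops (carrier S)"
proof -
  have "T_op S ` carrier S \<union> T_adj S ` carrier S \<subseteq> bounded_ops (carrier S)"
    using T_op_bounded T_adj_bounded by blast
  from cstar_gen_bounded[OF this] show ?thesis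
    unfolding C_red_def by blast
qed

lemma monomials_subset_C_red: "V \<in> monomials S \<Longrightarrow> V \<in> C_red S"
  unfolding C_red_def by (induction rule: monomials.induct) (blast intro: cstar_gen.gen cstar_gen.mult)+

lemma monomial_span_subset_C_red: "x \<in> monomial_span S \<Longrightarrow> x \<in> C_red S"
proof (induction rule: monomial_span.induct)
  case zero
  \<comment> \<open>\<open>cstar_gen\<close> has no clause for 0, so 0 is produced as a multiple of
    a generator.\<close>
  have "scale_op 0 (T_op S \<one>) \<in> C_red S"
    using T_op_in_C_red[OF one_closed] unfolding C_red_def by (rule cstar_gen.scale)
  then show ?case
    by (simp only: scale_op_zero)
next
  case (step x V c)
  then show ?case
    using monomials_subset_C_red unfolding C_red_def by (blast intro: cstar_gen.add cstar_gen.scale)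
qed

text \<open>The span of the monomials is closed under the algebraic operations and the adjoint, and
  these are norm continuous, so approximations can be combined. For a limit of limits, an element
  within \<open>1 / (n + 1)\<close> of the n-th term is chosen and the errors are added.\<close>

lemma C_red_approx:
  assumes "x \<in> C_red S"
  shows "\<exists>X. (\<forall>n. X n \<in> monomial_span S) \<and> op_tendsto X x"
  using assms unfolding C_red_def
proof induction
  case (gen A)
  then have "A \<in> monomials S"
    by (auto intro: monomials.shift monomials.shift_adj)
  moreover have "opnorm (A - A) = 0"
    by (simp only: diff_self opnorm_zero)
  ultimately show ?case
    by (intro exI[of _ "\<lambda>n. A"]) (simp add: op_tendsto_def monomial_in_span)
next
  case (add A B)
  then obtain X Y where X: "\<And>n. X n \<in> monomial_span S" "op_tendsto X A"
    and Y: "\<And>n. Y n \<in> monomial_span S" "op_tendsto Y B"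
    by blast
  have AB: "A \<in> bounded_ops (carrier S)" "B \<in> bounded_ops (carrier S)"
    using add.hyps C_red_bounded unfolding C_red_def by blast+
  have "op_tendsto (\<lambda>n. X n + Y n) (A + B)"
    by (rule op_tendsto_plus[OF monomial_span_bounded[OF X(1)] AB(1) X(2)
          monomial_span_bounded[OF Y(1)] AB(2) Y(2)])
  moreover have "X n + Y n \<in> monomial_span S" for n
    by (rule monomial_span_plus[OF X(1) Y(1)])
  ultimately show ?case
    by (intro exI[of _ "\<lambda>n. X n + Y n"] conjI allI)
next
  case (scale A c)
  then obtain X where X: "\<And>n. X n \<in> monomial_span S" "op_tendsto X A"
    by blast
  have A: "A \<in> bounded_ops (carrier S)"
    using scale.hyps C_red_bounded unfolding C_red_def by blast
  have "op_tendsto (\<lambda>n. scale_op c (X n)) (scale_op c A)"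
    by (rule op_tendsto_scale_op[OF monomial_span_bounded[OF X(1)] A X(2)])
  moreover have "scale_op c (X n) \<in> monomial_span S" for n
    by (rule monomial_span_scale[OF X(1)])
  ultimately show ?case
    by (intro exI[of _ "\<lambda>n. scale_op c (X n)"] conjI allI)
next
  case (mult A B)
  then obtain X Y where X: "\<And>n. X n \<in> monomial_span S" "op_tendsto X A"
    and Y: "\<And>n. Y n \<in> monomial_span S" "op_tendsto Y B"
    by blast
  have AB: "A \<in> bounded_ops (carrier S)" "B \<in> bounded_ops (carrier S)"
    using mult.hyps C_red_bounded unfolding C_red_def by blast+
  have "op_tendsto (\<lambda>n. X n \<circ> Y n) (A \<circ> B)"
    by (rule op_tendsto_comp[OF monomial_span_bounded[OF X(1)] AB(1) X(2)
          monomial_span_bounded[OF Y(1)] AB(2) Y(2)])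
  moreover have "X n \<circ> Y n \<in> monomial_span S" for n
    by (rule monomial_span_comp[OF X(1) Y(1)])
  ultimately show ?case
    by (intro exI[of _ "\<lambda>n. X n \<circ> Y n"] conjI allI)
next
  case (adj A)
  then obtain X where X: "\<And>n. X n \<in> monomial_span S" "op_tendsto X A"
    by blast
  have A: "A \<in> bounded_ops (carrier S)"
    using adj.hyps C_red_bounded unfolding C_red_def by blast
  have "op_tendsto (\<lambda>n. adj_op (carrier S) (X n)) (adj_op (carrier S) A)"
    by (rule op_tendsto_adj[OF monomial_span_bounded[OF X(1)] A X(2)])
  moreover have "adj_op (carrier S) (X n) \<in> monomial_span S" for n
    by (rule monomial_span_adj[OF X(1)])
  ultimately show ?case
    by (intro exI[of _ "\<lambda>n. adj_op (carrier S) (X n)"] conjI allI)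
next
  case (lim X A)
  have Xb: "X n \<in> bounded_ops (carrier S)" for n
    using lim.hyps(1) C_red_bounded unfolding C_red_def by blast
  have "\<exists>y \<in> monomial_span S. opnorm (y - X n) < inverse (real (Suc n))" for n
  proof -
    obtain Y where Y: "\<And>k. Y k \<in> monomial_span S" "(\<lambda>k. opnorm (Y k - X n)) \<longlonglongrightarrow> 0"
      using lim.IH unfolding op_tendsto_def by blast
    have "eventually (\<lambda>k. opnorm (Y k - X n) < inverse (real (Suc n))) sequentially"
      by (rule order_tendstoD(2)[OF Y(2)]) simp
    then show ?thesis
      using Y(1) by (auto dest!: eventually_happens)
  qed
  then obtain Y where Y: "\<And>n. Y n \<in> monomial_span S"
    "\<And>n. opnorm (Y n - X n) < inverse (real (Suc n))"
    by metis
  note Yb = monomial_span_bounded[OF Y(1)]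
  have "op_tendsto Y A"
  proof (rule op_tendstoI[OF Yb lim.hyps(2)])
    have "(\<lambda>n. inverse (real (Suc n)) + opnorm (X n - A)) \<longlonglongrightarrow> 0 + 0"
      using lim.hyps(3) unfolding op_tendsto_def by (intro tendsto_add LIMSEQ_inverse_real_of_nat)
    then show "(\<lambda>n. inverse (real (Suc n)) + opnorm (X n - A)) \<longlonglongrightarrow> 0"
      by simp
    fix n
    have "Y n - A = (Y n - X n) + (X n - A)"
      by (simp add: fun_eq_iff)
    then have "opnorm (Y n - A) \<le> opnorm (Y n - X n) + opnorm (X n - A)"
      using opnorm_plus[OF bounded_ops_diff[OF Yb Xb] bounded_ops_diff[OF Xb lim.hyps(2)]]
      by (simp only:)
    then show "opnorm (Y n - A) \<le> inverse (real (Suc n)) + opnorm (X n - A)"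
      using Y(2)[of n] by linarith
  qed
  then show ?case
    using Y(1) by blast
qed

section \<open>The comultiplication\<close>

text \<open>The difference \<open>p - q\<close> is the degree of the monomial.\<close>

lemma monomial_ket:
  assumes "V \<in> monomials S"
  shows "\<exists>p \<in> carrier S. \<exists>q \<in> carrier S. \<forall>c \<in> carrier S.
    V (ket c) = 0 \<or> (\<exists>c' \<in> carrier S. V (ket c) = ket c' \<and> c' \<otimes> q = p \<otimes> c)"
  using assms
proof induction
  case (shift a)
  then show ?case
    by (intro bexI[of _ a] bexI[of _ \<one>] ballI) (auto simp: T_op_ket)
next
  case (shift_adj a)
  \<comment> \<open>The adjoint of T_a has degree 0 - a. It sends the basis vector at
    \<open>a \<otimes> b\<close> back to the one at \<open>b\<close>, and annihilates those at
    elements not of this form.\<close>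
  have "T_adj S a (ket c) = 0 \<or> (\<exists>c' \<in> carrier S. T_adj S a (ket c) = ket c' \<and> c' \<otimes> a = \<one> \<otimes> c)"
    if c: "c \<in> carrier S" for c
  proof (cases "\<exists>b \<in> carrier S. c = a \<otimes> b")
    case True
    then obtain b where b: "b \<in> carrier S" "c = a \<otimes> b"
      by blast
    then have "T_adj S a (ket c) = (T_adj S a \<circ> T_op S a) (ket b)"
      using shift_adj by (simp add: T_op_ket)
    also have "\<dots> = ket b"
      using shift_adj b(1) by (simp only: T_adj_comp_T_op) (simp add: id_op_def)
    finally show ?thesis
      using shift_adj b by (auto simp: m_comm)
  next
    case False
    have "T_adj S a (ket c) x = 0" for x
      using False T_adj_ket[OF shift_adj _ c] bounded_ops_apply_outside[OF T_adj_bounded[OF shift_adj]]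
      by (cases "x \<in> carrier S") auto
    then show ?thesis
      by auto
  qed
  then show ?case
    using shift_adj one_closed by blast
next
  case (prod V W)
  obtain p q where pq: "p \<in> carrier S" "q \<in> carrier S"
    and V: "\<forall>c \<in> carrier S. V (ket c) = 0 \<or> (\<exists>c' \<in> carrier S. V (ket c) = ket c' \<and> c' \<otimes> q = p \<otimes> c)"
    using prod.IH(1) by (elim bexE) (rule that)
  obtain r s where rs: "r \<in> carrier S" "s \<in> carrier S"
    and W: "\<forall>c \<in> carrier S. W (ket c) = 0 \<or> (\<exists>c' \<in> carrier S. W (ket c) = ket c' \<and> c' \<otimes> s = r \<otimes> c)"
    using prod.IH(2) by (elim bexE) (rule that)
  \<comment> \<open>Degrees add under composition: (p - q) + (r - s) = (p + r) - (q + s).\<close>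
  have "(V \<circ> W) (ket c) = 0 \<or> (\<exists>c' \<in> carrier S. (V \<circ> W) (ket c) = ket c' \<and> c' \<otimes> (q \<otimes> s) = (p \<otimes> r) \<otimes> c)"
    if c: "c \<in> carrier S" for c
  proof (cases "(V \<circ> W) (ket c) = 0")
    case False
    then have "W (ket c) \<noteq> 0"
      using bounded_ops_zero[OF monomials_bounded[OF prod.hyps(1)]] by (metis comp_apply)
    then obtain d where d: "d \<in> carrier S" "W (ket c) = ket d" "d \<otimes> s = r \<otimes> c"
      using bspec[OF W c] by (elim disjE bexE conjE) (simp, rule that)
    then obtain e where e: "e \<in> carrier S" "V (ket d) = ket e" "e \<otimes> q = p \<otimes> d"
      using bspec[OF V d(1)] False d(2) by (elim disjE bexE conjE) (simp, rule that)
    have "e \<otimes> (q \<otimes> s) = (e \<otimes> q) \<otimes> s"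
      using e(1) pq rs by (simp add: m_assoc)
    also have "\<dots> = p \<otimes> (d \<otimes> s)"
      unfolding e(3) using d(1) pq rs by (simp add: m_assoc)
    also have "\<dots> = (p \<otimes> r) \<otimes> c"
      unfolding d(3) using c pq rs by (simp add: m_assoc)
    finally show ?thesis
      using d e by (intro disjI2 bexI[of _ e]) auto
  qed blast
  then show ?case
    using pq rs by (intro bexI[of _ "p \<otimes> r"] bexI[of _ "q \<otimes> s"] ballI m_closed)
qed

text \<open>The entries of a monomial are 0 or 1. Being idempotent, they are reproduced on the
  diagonal of V \<otimes> V, which is how \<Delta> x comes to contain the entries of
  \<open>x\<close>.\<close>

lemma monomial_coeff:
  assumes "V \<in> monomials S" "c \<in> carrier S"
  shows "V (ket c) x * V (ket c) x = V (ket c) x"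
proof -
  consider "V (ket c) = 0" | c' where "V (ket c) = ket c'"
    using monomial_ket[OF assms(1)] assms(2) by blast
  then show ?thesis
    by cases (simp_all add: ket_def)
qed

text \<open>Nonzero entries satisfy c' - c = p - q = d' - d. The identity is written without
  subtraction, and the common \<open>q\<close> is cancelled inside the semigroup.\<close>

lemma monomial_degree:
  assumes "V \<in> monomials S" and cd: "c \<in> carrier S" "d \<in> carrier S"
    and nz: "V (ket c) c' \<noteq> 0" "V (ket d) d' \<noteq> 0"
  shows "c' \<otimes> d = d' \<otimes> c"
proof -
  obtain p q where pq: "p \<in> carrier S" "q \<in> carrier S"
    and *: "\<forall>c \<in> carrier S. V (ket c) = 0 \<or> (\<exists>c' \<in> carrier S. V (ket c) = ket c' \<and> c' \<otimes> q = p \<otimes> c)"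
    using monomial_ket[OF assms(1)] by (elim bexE) (rule that)
  have "c' \<in> carrier S \<and> c' \<otimes> q = p \<otimes> c"
    using * cd(1) nz(1) by (metis ket_apply(2) zero_fun_apply)
  moreover have "d' \<in> carrier S \<and> d' \<otimes> q = p \<otimes> d"
    using * cd(2) nz(2) by (metis ket_apply(2) zero_fun_apply)
  ultimately have mem: "c' \<in> carrier S" "d' \<in> carrier S"
    and eq: "c' \<otimes> q = p \<otimes> c" "d' \<otimes> q = p \<otimes> d"
    by auto
  have "q \<otimes> (c' \<otimes> d) = (c' \<otimes> q) \<otimes> d"
    using mem pq cd by (simp add: m_ac)
  moreover have "(p \<otimes> c) \<otimes> d = (p \<otimes> d) \<otimes> c"
    using pq cd by (simp add: m_ac)
  moreover have "(d' \<otimes> q) \<otimes> c = q \<otimes> (d' \<otimes> c)"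
    using mem pq cd by (simp add: m_ac)
  ultimately have "q \<otimes> (c' \<otimes> d) = q \<otimes> (d' \<otimes> c)"
    by (simp only: eq)
  then show ?thesis
    by (rule cancel_left[OF pq(2) m_closed[OF mem(1) cd(2)] m_closed[OF mem(2) cd(1)]])
qed

lemma C_red_tensor_bounded:
  "min_tensor (carrier S) (carrier S) (C_red S) (C_red S) \<subseteq> bounded_ops (carrier S \<times> carrier S)"
  by (rule min_tensor_bounded[OF C_red_bounded C_red_bounded])

lemma comult_bounded:
  assumes "is_comult S \<Delta>" "x \<in> C_red S"
  shows "\<Delta> x \<in> bounded_ops (carrier S \<times> carrier S)"
  using assms C_red_tensor_bounded unfolding is_comult_def by blast

lemma comult_tendsto:
  assumes "is_comult S \<Delta>" "\<And>n. X n \<in> C_red S" "x \<in> C_red S" "op_tendsto X x"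
  shows "op_tendsto (\<lambda>n. \<Delta> (X n)) (\<Delta> x)"
  using assms unfolding is_comult_def op_continuous_on_def by blast

text \<open>Two comultiplications agree on combinations of monomials by the defining formula. These
  are dense in \<open>C_red S\<close>, so the entries of both images of \<open>x\<close> are limits
  of the same sequence.\<close>

lemma comult_unique:
  assumes \<Delta>: "is_comult S \<Delta>" and \<Delta>': "is_comult S \<Delta>'"
  shows "\<Delta> = \<Delta>'"
proof (rule extensionalityI[of _ "C_red S"])
  show "\<Delta> \<in> extensional (C_red S)" "\<Delta>' \<in> extensional (C_red S)"
    using assms by (simp_all add: is_comult_def)
  fix x assume x: "x \<in> C_red S"
  obtain X where X: "\<And>n. X n \<in> monomial_span S" "op_tendsto X x"
    using C_red_approx[OF x] by blast
  note XC = monomial_span_subset_C_red[OF X(1)]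
  have eq: "\<Delta> (X n) = \<Delta>' (X n)" for n
  proof -
    obtain k :: nat and c V where "\<forall>i<k. V i \<in> monomials S" "X n = (\<Sum>i<k. scale_op (c i) (V i))"
      using monomial_span_sum[OF X(1)] by blast
    then show ?thesis
      using assms unfolding is_comult_def by simp
  qed
  show "\<Delta> x = \<Delta>' x"
  proof (rule bounded_ops_eqI[OF comult_bounded[OF \<Delta> x] comult_bounded[OF \<Delta>' x]])
    fix z assume "z \<in> carrier S \<times> carrier S"
    then have z: "ket z \<in> ell2 (carrier S \<times> carrier S)"
      by (rule ket_ell2)
    show "\<Delta> x (ket z) = \<Delta>' x (ket z)"
    proof
      fix w
      have "(\<lambda>n. \<Delta> (X n) (ket z) w) \<longlonglongrightarrow> \<Delta> x (ket z) w"
        by (rule op_tendsto_apply[OF comult_bounded[OF \<Delta> XC] comult_bounded[OF \<Delta> x] z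
              comult_tendsto[OF \<Delta> XC x X(2)]])
      moreover have "(\<lambda>n. \<Delta>' (X n) (ket z) w) \<longlonglongrightarrow> \<Delta>' x (ket z) w"
        by (rule op_tendsto_apply[OF comult_bounded[OF \<Delta>' XC] comult_bounded[OF \<Delta>' x] z
              comult_tendsto[OF \<Delta>' XC x X(2)]])
      ultimately show "\<Delta> x (ket z) w = \<Delta>' x (ket z) w"
        unfolding eq by (rule LIMSEQ_unique)
    qed
  qed
qed

text \<open>On a combination of monomials the entry of \<Delta> from \<open>(c, d)\<close> to
  \<open>(c', d')\<close> is the sum of \<open>a i * (V i (ket c) c' * V i (ket d) d')\<close>. On
  the diagonal idempotence removes one of the two factors; between different degrees every summand
  vanishes. Both facts survive entrywise limits.\<close>

lemma
  assumes \<Delta>: "is_comult S \<Delta>" and x: "x \<in> C_red S" and c: "c \<in> carrier S"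
  shows comult_diag: "\<Delta> x (ket (c, c)) (c', c') = x (ket c) c'"
    and comult_off_degree: "d \<in> carrier S \<Longrightarrow> c' \<otimes> d \<noteq> d' \<otimes> c \<Longrightarrow> \<Delta> x (ket (c, d)) (c', d') = 0"
proof -
  obtain X where X: "\<And>n. X n \<in> monomial_span S" "op_tendsto X x"
    using C_red_approx[OF x] by blast
  note XC = monomial_span_subset_C_red[OF X(1)]
  have lim: "(\<lambda>n. \<Delta> (X n) (ket (c, d)) w) \<longlonglongrightarrow> \<Delta> x (ket (c, d)) w" if "d \<in> carrier S" for d w
    using that c by (intro op_tendsto_apply[OF comult_bounded[OF \<Delta> XC] comult_bounded[OF \<Delta> x] _
              comult_tendsto[OF \<Delta> XC x X(2)]]) simp
  \<comment> \<open>A presentation of \<open>X n\<close> by monomials is not unique, so one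
    presentation has to be fixed that serves both \<open>X n\<close> and its image under
    \<Delta>.\<close>
  have coeff: "\<exists>(k::nat) a V. (\<forall>i<k. V i \<in> monomials S) \<and> X n = (\<Sum>i<k. scale_op (a i) (V i)) \<and>
      (\<forall>d \<in> carrier S. \<forall>c' d'. \<Delta> (X n) (ket (c, d)) (c', d') =
        (\<Sum>i<k. a i * (V i (ket c) c' * V i (ket d) d')))" for n
  proof -
    obtain k :: nat and a V where V: "\<forall>i<k. V i \<in> monomials S"
      and Xn: "X n = (\<Sum>i<k. scale_op (a i) (V i))"
      using monomial_span_sum[OF X(1)] by blast
    have "\<Delta> (X n) = (\<Sum>i<k. scale_op (a i) (tensor_op (carrier S) (carrier S) (V i) (V i)))"
      using \<Delta> V unfolding Xn is_comult_def by blast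
    then have "\<Delta> (X n) (ket (c, d)) (c', d') = (\<Sum>i<k. a i * (V i (ket c) c' * V i (ket d) d'))"
      if "d \<in> carrier S" for d c' d'
      using V c that
      by (auto simp: sum_fun_apply2 scale_op_def tensor_op_ket[OF monomials_bounded monomials_bounded]
          intro!: sum.cong)
    then show ?thesis
      using V Xn by blast
  qed
  have "\<Delta> (X n) (ket (c, c)) (c', c') = X n (ket c) c'" for n
  proof -
    obtain k :: nat and a V where "\<forall>i<k. V i \<in> monomials S" "X n = (\<Sum>i<k. scale_op (a i) (V i))"
      "\<Delta> (X n) (ket (c, c)) (c', c') = (\<Sum>i<k. a i * (V i (ket c) c' * V i (ket c) c'))"
      using coeff[of n] c by blast
    then show ?thesis
      using monomial_coeff[OF _ c] by (simp add: sum_fun_apply2 scale_op_def)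
  qed
  moreover have "(\<lambda>n. X n (ket c) c') \<longlonglongrightarrow> x (ket c) c'"
    using C_red_bounded x XC by (intro op_tendsto_apply[OF _ _ ket_ell2[OF c] X(2)]) auto
  ultimately show "\<Delta> x (ket (c, c)) (c', c') = x (ket c) c'"
    using lim[OF c, of "(c', c')"] by (simp add: LIMSEQ_unique)
  show "\<Delta> x (ket (c, d)) (c', d') = 0" if d: "d \<in> carrier S" and ne: "c' \<otimes> d \<noteq> d' \<otimes> c"
  proof -
    have "\<Delta> (X n) (ket (c, d)) (c', d') = 0" for n
    proof -
      obtain k :: nat and a V where V: "\<forall>i<k. V i \<in> monomials S"
        and eq: "\<Delta> (X n) (ket (c, d)) (c', d') = (\<Sum>i<k. a i * (V i (ket c) c' * V i (ket d) d'))"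
        using coeff[of n] d by blast
      have "V i (ket c) c' * V i (ket d) d' = 0" if "i < k" for i
        using monomial_degree[OF _ c d] V that ne by (metis mult_eq_0_iff)
      then show ?thesis
        unfolding eq by (intro sum.neutral) auto
    qed
    then show ?thesis
      using lim[OF d, of "(c', d')"] by (simp add: LIMSEQ_const_iff)
  qed
qed

lemma comult_T_op:
  assumes \<Delta>: "is_comult S \<Delta>" and a: "a \<in> carrier S"
  shows "\<Delta> (T_op S a) = tensor_op (carrier S) (carrier S) (T_op S a) (T_op S a)"
proof -
  have "\<forall>(n::nat) c V. (\<forall>i<n. V i \<in> monomials S) \<longrightarrow>
       \<Delta> (\<Sum>i<n. scale_op (c i) (V i)) =
       (\<Sum>i<n. scale_op (c i) (tensor_op (carrier S) (carrier S) (V i) (V i)))"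
    using \<Delta> by (simp add: is_comult_def)
  from this[rule_format, of 1 "\<lambda>_. T_op S a" "\<lambda>_. 1"] show ?thesis
    using monomials.shift[OF a] by (simp only: lessThan_Suc One_nat_def) simp
qed

text \<open>The matrix entries of a group-like element are idempotent and sit in a single degree;
  for an isometry the column of the neutral element shows that this degree is in \<open>S\<close>.\<close>

lemma grouplike_isometry:
  assumes \<Delta>: "is_comult S \<Delta>" and x: "x \<in> C_red S"
    and grp: "\<Delta> x = tensor_op (carrier S) (carrier S) x x"
    and iso: "adj_op (carrier S) x \<circ> x = id_op (carrier S)"
  shows "\<exists>a \<in> carrier S. x = T_op S a"
proof -
  have xb: "x \<in> bounded_ops (carrier S)"
    using x C_red_bounded by blast
  have coeff: "\<Delta> x (ket (c, d)) (c', d') = x (ket c) c' * x (ket d) d'"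
    if "c \<in> carrier S" "d \<in> carrier S" for c d c' d'
    unfolding grp using that by (rule tensor_op_ket[OF xb xb])
  \<comment> \<open>The diagonal entry of \<Delta> x is the entry of \<open>x\<close>, and in x
    \<otimes> x it is the square of that entry.\<close>
  have idem: "x (ket c) c' = 0 \<or> x (ket c) c' = 1" if c: "c \<in> carrier S" for c c'
    using coeff[OF c c, of c' c'] comult_diag[OF \<Delta> x c, of c'] by simp
  have degree: "c' \<otimes> d = d' \<otimes> c"
    if c: "c \<in> carrier S" and d: "d \<in> carrier S" and "x (ket c) c' \<noteq> 0" "x (ket d) d' \<noteq> 0" for c d c' d'
    using comult_off_degree[OF \<Delta> x c d, of c' d'] coeff[OF c d, of c' d'] that(3,4) by auto
  \<comment> \<open>The isometry condition enters here: a vanishing column at \<open>c\<close> would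
    make the adjoint of \<open>x\<close> composed with \<open>x\<close> annihilate
    \<open>ket c\<close>.\<close>
  have column: "\<exists>c' \<in> carrier S. x (ket c) c' \<noteq> 0" if c: "c \<in> carrier S" for c
  proof (rule ccontr)
    assume "\<not> ?thesis"
    then have "x (ket c) = 0"
      using bounded_ops_apply_outside[OF xb] by (metis ext zero_fun_apply)
    then have "id_op (carrier S) (ket c) = 0"
      using bounded_ops_zero[OF bounded_ops_adj[OF xb]] iso by (metis comp_apply)
    then have "ket c c = 0"
      using c by (metis id_op_def ket_ell2 zero_fun_apply)
    then show False
      by simp
  qed
  obtain a where a: "a \<in> carrier S" "x (ket \<one>) a \<noteq> 0"
    using column[OF one_closed] by blast
  have "x (ket c) = ket (a \<otimes> c)" if c: "c \<in> carrier S" for c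
  proof -
    \<comment> \<open>The entry at \<open>a\<close> in the column of \<one> fixes the degree;
      comparing with column \<open>c\<close> gives
      \<open>a \<otimes> c = c' \<otimes> \<one>\<close>.\<close>
    have shape: "c' = a \<otimes> c" if "c' \<in> carrier S" "x (ket c) c' \<noteq> 0" for c'
      using degree[OF one_closed c a(2) that(2)] that(1) by simp
    obtain c' where "c' \<in> carrier S" "x (ket c) c' \<noteq> 0"
      using column[OF c] by blast
    then have "x (ket c) (a \<otimes> c) = 1"
      using shape idem[OF c] by metis
    moreover have "x (ket c) y = 0" if "y \<noteq> a \<otimes> c" for y
      using that shape bounded_ops_apply_outside[OF xb] by blast
    ultimately show ?thesis
      by (auto simp: ket_def)
  qed
  then have "x = T_op S a"
    using a(1) by (intro T_op_eqI[OF xb])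
  then show ?thesis
    using a(1) by blast
qed

end

section \<open>The two categories\<close>

lemma sab_semigroup_cancellative:
  assumes "sab_semigroup S"
  shows "cancellative_monoid S"
proof -
  interpret comm_monoid S
    using assms by (simp add: sab_semigroup_def)
  show ?thesis
    using assms unfolding sab_semigroup_def by unfold_locales blast
qed

lemma hom_funcset: "\<phi> \<in> hom S R \<Longrightarrow> \<phi> \<in> carrier S \<rightarrow> carrier R"
  by (simp add: hom_def)

lemma S_ab_ident:
  assumes "sab_semigroup S"
  shows "(\<lambda>a\<in>carrier S. a) \<in> hom S S"
proof -
  interpret cancellative_monoid S
    using assms by (rule sab_semigroup_cancellative)
  show ?thesis
    by (auto simp: hom_def)
qed

lemma S_ab_comp:
  assumes "sab_semigroup S" "\<phi> \<in> hom S R" "\<psi> \<in> hom R Q"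
  shows "compose (carrier S) \<psi> \<phi> \<in> hom S Q"
proof -
  interpret cancellative_monoid S
    using assms(1) by (rule sab_semigroup_cancellative)
  show ?thesis
    using assms(2,3) by (auto simp: hom_def compose_def Pi_iff)
qed

lemma category_S_ab: "category S_ab"
  by unfold_locales
    (auto simp: S_ab_def S_ab_ident S_ab_comp compose_extensional
      intro: compose_Id[OF hom_funcset] Id_compose[OF hom_funcset] compose_assoc[OF hom_funcset])

text \<open>A relation and not a function in either direction: a semigroup may admit no \<Delta>,
  and an object may come from several operations on the same carrier.\<close>

definition presents :: "'a monoid \<Rightarrow> 'a qsemigroup \<Rightarrow> bool" where
  "presents S Q \<longleftrightarrow> sab_semigroup S \<and> is_comult S (comult Q) \<and>
    idx Q = carrier S \<and> alg Q = C_red S"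

lemma presentsD:
  assumes "presents S Q"
  shows "sab_semigroup S" "cancellative_monoid S" "is_comult S (comult Q)"
    "idx Q = carrier S" "alg Q = C_red S"
  using assms by (auto simp: presents_def sab_semigroup_cancellative)

lemma qs_objects_iff: "Q \<in> qs_objects \<longleftrightarrow> (\<exists>S. presents S Q)"
  by (cases Q) (auto simp: qs_objects_def presents_def)

lemma presents_unique:
  assumes "presents S P" "presents S Q"
  shows "P = Q"
proof -
  interpret cancellative_monoid S
    using assms(1) by (rule presentsD)
  have "comult P = comult Q"
    using assms by (intro comult_unique) (auto simp: presents_def)
  then show ?thesis
    using assms by (auto simp: presents_def)
qed

lemma C_red_closed:
  shows "x \<in> C_red S \<Longrightarrow> y \<in> C_red S \<Longrightarrow> x + y \<in> C_red S"
    and "x \<in> C_red S \<Longrightarrow> y \<in> C_red S \<Longrightarrow> x \<circ> y \<in> C_red S"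
    and "x \<in> C_red S \<Longrightarrow> scale_op c x \<in> C_red S"
    and "x \<in> C_red S \<Longrightarrow> adj_op (carrier S) x \<in> C_red S"
  unfolding C_red_def
  by (rule cstar_gen.add cstar_gen.mult cstar_gen.scale cstar_gen.adj, assumption+)+

lemma qs_hom_ident:
  assumes "P \<in> qs_objects"
  shows "(\<lambda>x\<in>alg P. x) \<in> qs_hom P P"
proof -
  obtain S where S: "presents S P"
    using assms by (auto simp: qs_objects_iff)
  interpret cancellative_monoid S
    using S by (rule presentsD)
  note [simp] = presentsD(4,5)[OF S]
  have "is_tensor_map P P (\<lambda>x\<in>alg P. x) (\<lambda>x. x)"
    by (simp add: is_tensor_map_def op_continuous_on_def)
  moreover have "comult P x \<in> alg_tensor P" if "x \<in> alg P" for x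
    using presentsD(3)[OF S] that by (simp add: is_comult_def alg_tensor_def)
  moreover have "unital_star_hom P P (\<lambda>x\<in>alg P. x)"
  proof -
    \<comment> \<open>The restricted identity map has its intended value at the unit only if the
      unit lies in the algebra; it does, being the translation by \<one>.\<close>
    have "id_op (carrier S) \<in> C_red S"
      using T_op_in_C_red[OF one_closed] by (simp only: T_op_one)
    then show ?thesis
      unfolding unital_star_hom_def presentsD(4,5)[OF S]
      by (intro conjI ballI allI) (simp_all only: restrict_apply C_red_closed if_True)
  qed
  ultimately show ?thesis
    unfolding qs_hom_def by (auto intro!: exI[of _ "\<lambda>x. x"])
qed

lemma is_tensor_map_comp:
  assumes \<Theta>: "is_tensor_map P Q \<pi> \<Theta>" and \<Theta>': "is_tensor_map Q R \<rho> \<Theta>'"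
    and \<pi>: "\<And>x. x \<in> alg P \<Longrightarrow> \<pi> x \<in> alg Q"
  shows "is_tensor_map P R (compose (alg P) \<rho> \<pi>) (\<lambda>x. \<Theta>' (\<Theta> x))"
  unfolding is_tensor_map_def
proof (intro conjI ballI allI)
  have cont: "op_continuous_on (alg_tensor P) \<Theta>" "op_continuous_on (alg_tensor Q) \<Theta>'"
    and mem: "\<And>x. x \<in> alg_tensor P \<Longrightarrow> \<Theta> x \<in> alg_tensor Q"
    using \<Theta> \<Theta>' by (simp_all add: is_tensor_map_def)
  show "op_continuous_on (alg_tensor P) (\<lambda>x. \<Theta>' (\<Theta> x))"
    unfolding op_continuous_on_def
  proof (intro allI impI)
    fix X A
    assume X: "(\<forall>n. X n \<in> alg_tensor P) \<and> A \<in> alg_tensor P \<and> op_tendsto X A"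
    then have "op_tendsto (\<lambda>n. \<Theta> (X n)) (\<Theta> A)"
      using cont(1) unfolding op_continuous_on_def by blast
    then show "op_tendsto (\<lambda>n. \<Theta>' (\<Theta> (X n))) (\<Theta>' (\<Theta> A))"
      using cont(2)[unfolded op_continuous_on_def, rule_format, of "\<lambda>n. \<Theta> (X n)" "\<Theta> A"] X mem
      by blast
  qed
  fix x y c
  show "x \<in> alg_tensor P \<Longrightarrow> \<Theta>' (\<Theta> x) \<in> alg_tensor R"
    using \<Theta> \<Theta>' by (simp add: is_tensor_map_def)
  show "x \<in> alg_tensor P \<Longrightarrow> \<Theta>' (\<Theta> (scale_op c x)) = scale_op c (\<Theta>' (\<Theta> x))"
    using \<Theta> \<Theta>' by (simp add: is_tensor_map_def)
  show "x \<in> alg_tensor P \<Longrightarrow> y \<in> alg_tensor P \<Longrightarrow> \<Theta>' (\<Theta> (x + y)) = \<Theta>' (\<Theta> x) + \<Theta>' (\<Theta> y)"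
    using \<Theta> \<Theta>' unfolding is_tensor_map_def by (metis (no_types, lifting))
next
  fix x y
  assume "x \<in> alg P" "y \<in> alg P"
  then show "\<Theta>' (\<Theta> (tensor_op (idx P) (idx P) x y)) =
    tensor_op (idx R) (idx R) (compose (alg P) \<rho> \<pi> x) (compose (alg P) \<rho> \<pi> y)"
    using \<Theta> \<Theta>' \<pi> by (simp add: is_tensor_map_def compose_eq)
qed

lemma qs_hom_mem: "\<pi> \<in> qs_hom P Q \<Longrightarrow> x \<in> alg P \<Longrightarrow> \<pi> x \<in> alg Q"
  by (auto simp: qs_hom_def unital_star_hom_def)

lemma qs_hom_funcset: "\<pi> \<in> qs_hom P Q \<Longrightarrow> \<pi> \<in> alg P \<rightarrow> alg Q"
  by (auto simp: qs_hom_mem)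

lemma qs_hom_extensional: "\<pi> \<in> qs_hom P Q \<Longrightarrow> \<pi> \<in> extensional (alg P)"
  by (simp add: qs_hom_def)

text \<open>The composite of the two tensor maps serves as the tensor map of the composite. Closure
  of \<open>alg P\<close>, including its unit, lets \<open>compose\<close> be evaluated at every
  argument that occurs in the laws.\<close>

lemma qs_hom_comp:
  assumes P: "P \<in> qs_objects" and \<pi>: "\<pi> \<in> qs_hom P Q" and \<rho>: "\<rho> \<in> qs_hom Q R"
  shows "compose (alg P) \<rho> \<pi> \<in> qs_hom P R"
proof -
  obtain S where S: "presents S P"
    using P by (auto simp: qs_objects_iff)
  interpret cancellative_monoid S
    using S by (rule presentsD)
  have u\<pi>: "unital_star_hom P Q \<pi>" and u\<rho>: "unital_star_hom Q R \<rho>"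
    using \<pi> \<rho> by (simp_all add: qs_hom_def)
  obtain \<Theta> \<Theta>' where \<Theta>: "is_tensor_map P Q \<pi> \<Theta>" "\<And>x. x \<in> alg P \<Longrightarrow> comult Q (\<pi> x) = \<Theta> (comult P x)"
    and \<Theta>': "is_tensor_map Q R \<rho> \<Theta>'" "\<And>x. x \<in> alg Q \<Longrightarrow> comult R (\<rho> x) = \<Theta>' (comult Q x)"
    using \<pi> \<rho> unfolding qs_hom_def by blast
  note closed = C_red_closed[of _ S, folded presentsD(4,5)[OF S]]
  have "id_op (idx P) \<in> alg P"
    using T_op_in_C_red[OF one_closed] by (simp only: T_op_one presentsD(4,5)[OF S])
  then have "unital_star_hom P R (compose (alg P) \<rho> \<pi>)"
    unfolding unital_star_hom_def
    using u\<pi>[unfolded unital_star_hom_def] u\<rho>[unfolded unital_star_hom_def] closed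
    by (intro conjI ballI allI) (simp_all only: compose_eq)
  moreover have "is_tensor_map P R (compose (alg P) \<rho> \<pi>) (\<lambda>x. \<Theta>' (\<Theta> x))"
    using \<Theta>(1) \<Theta>'(1) qs_hom_mem[OF \<pi>] by (rule is_tensor_map_comp)
  moreover have "comult R (compose (alg P) \<rho> \<pi> x) = \<Theta>' (\<Theta> (comult P x))" if "x \<in> alg P" for x
    using that \<Theta>(2) \<Theta>'(2) qs_hom_mem[OF \<pi> that] by (simp add: compose_eq)
  ultimately show ?thesis
    unfolding qs_hom_def using compose_extensional by blast
qed

lemma category_QS_red: "category QS_red"
  by unfold_locales
    (auto simp: QS_red_def qs_hom_ident qs_hom_comp
      intro: compose_Id[OF qs_hom_funcset] Id_compose[OF qs_hom_funcset]
        compose_assoc[OF qs_hom_funcset] qs_hom_extensional)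

section \<open>Morphisms of quantum semigroups\<close>

text \<open>Compatibility with \<Delta> turns T_a \<otimes> T_a into \<pi> T_a \<otimes> \<pi> T_a,
  and preservation of products, adjoints and unit keeps the isometry relation. Hence the image is a
  group-like isometry over \<open>R\<close>, so a translation.\<close>

lemma qs_hom_T_op:
  assumes S: "presents S P" and R: "presents R Q" and \<pi>: "\<pi> \<in> qs_hom P Q" and a: "a \<in> carrier S"
  shows "\<exists>b \<in> carrier R. \<pi> (T_op S a) = T_op R b"
proof -
  interpret S: cancellative_monoid S
    using S by (rule presentsD)
  interpret R: cancellative_monoid R
    using R by (rule presentsD)
  note T = S.T_op_in_C_red[OF a] and T' = S.monomials_subset_C_red[OF monomials.shift_adj[OF a]]
  have hom: "unital_star_hom P Q \<pi>"
    using \<pi> by (simp add: qs_hom_def)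
  obtain \<Theta> where \<Theta>: "is_tensor_map P Q \<pi> \<Theta>" "\<And>x. x \<in> C_red S \<Longrightarrow> comult Q (\<pi> x) = \<Theta> (comult P x)"
    using \<pi> unfolding qs_hom_def presentsD(5)[OF S] by blast
  have "\<pi> (T_op S a) \<in> C_red R"
    using qs_hom_mem[OF \<pi>] T by (simp add: presentsD(5)[OF S] presentsD(5)[OF R])
  moreover have "comult Q (\<pi> (T_op S a)) =
      tensor_op (carrier R) (carrier R) (\<pi> (T_op S a)) (\<pi> (T_op S a))"
    using \<Theta>(1) T unfolding \<Theta>(2)[OF T] S.comult_T_op[OF presentsD(3)[OF S] a] is_tensor_map_def
      presentsD(4,5)[OF S] presentsD(4)[OF R] by blast
  moreover have "adj_op (carrier R) (\<pi> (T_op S a)) \<circ> \<pi> (T_op S a) = id_op (carrier R)"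
  proof -
    have "adj_op (carrier R) (\<pi> (T_op S a)) = \<pi> (T_adj S a)"
      using hom T unfolding unital_star_hom_def presentsD(4,5)[OF S] presentsD(4)[OF R] T_adj_def
      by metis
    moreover have "\<pi> (T_adj S a) \<circ> \<pi> (T_op S a) = \<pi> (T_adj S a \<circ> T_op S a)"
      using hom T T' unfolding unital_star_hom_def presentsD(5)[OF S] by metis
    moreover have "\<pi> (id_op (carrier S)) = id_op (carrier R)"
      using hom unfolding unital_star_hom_def presentsD(4)[OF S] presentsD(4)[OF R] by metis
    ultimately show ?thesis
      by (simp only: S.T_adj_comp_T_op[OF a])
  qed
  ultimately show ?thesis
    by (rule R.grouplike_isometry[OF presentsD(3)[OF R]])
qed

text \<open>Morphisms are not assumed continuous. The continuity needed for the uniqueness comes from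
  \<open>\<pi> \<otimes> \<pi>\<close>: the entries of \<open>\<pi> x\<close> are diagonal entries of \<open>\<Delta> (\<pi> x) = (\<pi> \<otimes> \<pi>) (\<Delta> x)\<close>.\<close>

lemma qs_hom_entry_tendsto:
  assumes S: "presents S P" and R: "presents R Q" and \<pi>: "\<pi> \<in> qs_hom P Q"
    and X: "\<And>n. X n \<in> C_red S" and A: "A \<in> C_red S" and lim: "op_tendsto X A" and c: "c \<in> carrier R"
  shows "(\<lambda>n. \<pi> (X n) (ket c) y) \<longlonglongrightarrow> \<pi> A (ket c) y"
proof -
  interpret S: cancellative_monoid S
    using S by (rule presentsD)
  interpret R: cancellative_monoid R
    using R by (rule presentsD)
  obtain \<Theta> where \<Theta>: "is_tensor_map P Q \<pi> \<Theta>" "\<And>x. x \<in> C_red S \<Longrightarrow> comult Q (\<pi> x) = \<Theta> (comult P x)"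
    using \<pi> unfolding qs_hom_def presentsD(5)[OF S] by blast
  have mem: "\<pi> x \<in> C_red R" if "x \<in> C_red S" for x
    using qs_hom_mem[OF \<pi>] that by (simp add: presentsD(5)[OF S] presentsD(5)[OF R])
  have bounded: "comult Q (\<pi> x) \<in> bounded_ops (carrier R \<times> carrier R)" if "x \<in> C_red S" for x
    by (rule R.comult_bounded[OF presentsD(3)[OF R] mem[OF that]])
  have tensor: "comult P x \<in> alg_tensor P" if "x \<in> C_red S" for x
    using presentsD(3)[OF S] that unfolding is_comult_def alg_tensor_def presentsD(4,5)[OF S] by blast
  have lim': "op_tendsto (\<lambda>n. comult P (X n)) (comult P A)"
    by (rule S.comult_tendsto[OF presentsD(3)[OF S] X A lim])
  have cont: "op_continuous_on (alg_tensor P) \<Theta>"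
    using \<Theta>(1) by (simp add: is_tensor_map_def)
  have "op_tendsto (\<lambda>n. \<Theta> (comult P (X n))) (\<Theta> (comult P A))"
    using cont[unfolded op_continuous_on_def, rule_format, of "\<lambda>n. comult P (X n)" "comult P A"]
      lim' tensor[OF X] tensor[OF A] by blast
  then have "op_tendsto (\<lambda>n. comult Q (\<pi> (X n))) (comult Q (\<pi> A))"
    by (simp only: \<Theta>(2)[OF X] \<Theta>(2)[OF A])
  then have "(\<lambda>n. comult Q (\<pi> (X n)) (ket (c, c)) (y, y)) \<longlonglongrightarrow> comult Q (\<pi> A) (ket (c, c)) (y, y)"
    using c by (intro op_tendsto_apply[OF bounded[OF X] bounded[OF A]]) simp_all
  then show ?thesis
    by (simp only: R.comult_diag[OF presentsD(3)[OF R] mem[OF X] c]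
        R.comult_diag[OF presentsD(3)[OF R] mem[OF A] c])
qed

text \<open>Agreement on the T_a passes to their adjoints because both maps preserve adjoints, to
  sums, multiples and products by the homomorphism laws, and to norm limits entry by entry.\<close>

lemma qs_hom_eqI:
  assumes S: "presents S P" and R: "presents R Q" and \<pi>: "\<pi> \<in> qs_hom P Q" and \<rho>: "\<rho> \<in> qs_hom P Q"
    and eq: "\<And>a. a \<in> carrier S \<Longrightarrow> \<pi> (T_op S a) = \<rho> (T_op S a)"
  shows "\<pi> = \<rho>"
proof (rule extensionalityI[OF qs_hom_extensional[OF \<pi>] qs_hom_extensional[OF \<rho>]])
  interpret S: cancellative_monoid S
    using S by (rule presentsD)
  interpret R: cancellative_monoid R
    using R by (rule presentsD)
  have hom: "unital_star_hom P Q \<pi>" "unital_star_hom P Q \<rho>"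
    using \<pi> \<rho> by (simp_all add: qs_hom_def)
  note hom = hom[unfolded unital_star_hom_def presentsD(4,5)[OF S]]
  have bounded: "\<sigma> x \<in> bounded_ops (carrier R)" if "\<sigma> \<in> qs_hom P Q" "x \<in> C_red S" for \<sigma> x
    using qs_hom_mem[OF that(1)] that(2) R.C_red_bounded
    by (auto simp: presentsD(5)[OF S] presentsD(5)[OF R])
  fix x assume "x \<in> alg P"
  then have "x \<in> cstar_gen (carrier S) (T_op S ` carrier S \<union> T_adj S ` carrier S)"
    by (simp add: presentsD(5)[OF S] C_red_def)
  then show "\<pi> x = \<rho> x"
  proof induction
    case (gen A)
    then obtain a where a: "a \<in> carrier S" "A = T_op S a \<or> A = T_adj S a"
      by blast
    then show ?case
      using hom S.T_op_in_C_red[OF a(1)] eq[OF a(1)] unfolding T_adj_def by metis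
  next
    case (add A B)
    then show ?case
      using hom unfolding C_red_def by metis
  next
    case (scale A c)
    then show ?case
      using hom unfolding C_red_def by metis
  next
    case (mult A B)
    then show ?case
      using hom unfolding C_red_def by metis
  next
    case (adj A)
    then show ?case
      using hom unfolding C_red_def by metis
  next
    case (lim X A)
    have X: "X n \<in> C_red S" for n
      using lim.hyps(1) by (simp add: C_red_def)
    have A: "A \<in> C_red S"
      using cstar_gen.lim[OF lim.hyps] by (simp add: C_red_def)
    show ?case
    proof (rule bounded_ops_eqI[OF bounded[OF \<pi> A] bounded[OF \<rho> A]], rule ext)
      fix c y assume c: "c \<in> carrier R"
      have "(\<lambda>n. \<pi> (X n) (ket c) y) \<longlonglongrightarrow> \<pi> A (ket c) y"
        by (rule qs_hom_entry_tendsto[OF S R \<pi> X A lim.hyps(3) c])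
      moreover have "(\<lambda>n. \<rho> (X n) (ket c) y) \<longlonglongrightarrow> \<rho> A (ket c) y"
        by (rule qs_hom_entry_tendsto[OF S R \<rho> X A lim.hyps(3) c])
      ultimately show "\<pi> A (ket c) y = \<rho> A (ket c) y"
        unfolding lim.IH by (rule LIMSEQ_unique)
    qed
  qed
qed

section \<open>The induced semigroup homomorphism and the functor\<close>

definition hom_of :: "'a monoid \<Rightarrow> 'a monoid \<Rightarrow> ('a oper \<Rightarrow> 'a oper) \<Rightarrow> 'a \<Rightarrow> 'a" where
  "hom_of S R \<pi> = (\<lambda>a\<in>carrier S. THE b. b \<in> carrier R \<and> \<pi> (T_op S a) = T_op R b)"

lemma hom_of_eqI:
  assumes R: "presents R Q" and ab: "a \<in> carrier S" "b \<in> carrier R" and eq: "\<pi> (T_op S a) = T_op R b"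
  shows "hom_of S R \<pi> a = b"
proof -
  interpret R: cancellative_monoid R
    using R by (rule presentsD)
  show ?thesis
    using ab eq by (auto simp: hom_of_def dest: R.T_op_inj intro!: the_equality)
qed

lemma hom_of:
  assumes S: "presents S P" and R: "presents R Q" and \<pi>: "\<pi> \<in> qs_hom P Q" and a: "a \<in> carrier S"
  shows "hom_of S R \<pi> a \<in> carrier R" and "\<pi> (T_op S a) = T_op R (hom_of S R \<pi> a)"
  using qs_hom_T_op[OF assms] hom_of_eqI[where \<pi> = \<pi>, OF R a] by auto

text \<open>Translations and \<pi> are both multiplicative, and a translation determines its label,
  so the label attached to a product is the product of the labels.\<close>

lemma hom_of_hom:
  assumes S: "presents S P" and R: "presents R Q" and \<pi>: "\<pi> \<in> qs_hom P Q"
  shows "hom_of S R \<pi> \<in> hom S R"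
proof -
  interpret S: cancellative_monoid S
    using S by (rule presentsD)
  interpret R: cancellative_monoid R
    using R by (rule presentsD)
  note \<phi> = hom_of[OF S R \<pi>]
  have "hom_of S R \<pi> (a \<otimes>\<^bsub>S\<^esub> b) = hom_of S R \<pi> a \<otimes>\<^bsub>R\<^esub> hom_of S R \<pi> b"
    if a: "a \<in> carrier S" and b: "b \<in> carrier S" for a b
  proof (rule hom_of_eqI[OF R])
    have "\<pi> (T_op S a \<circ> T_op S b) = \<pi> (T_op S a) \<circ> \<pi> (T_op S b)"
      using \<pi> S.T_op_in_C_red[OF a] S.T_op_in_C_red[OF b]
      unfolding qs_hom_def unital_star_hom_def presentsD(5)[OF S] by blast
    then show "\<pi> (T_op S (a \<otimes>\<^bsub>S\<^esub> b)) = T_op R (hom_of S R \<pi> a \<otimes>\<^bsub>R\<^esub> hom_of S R \<pi> b)"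
      by (simp only: S.T_op_mult[OF a b] R.T_op_mult[OF \<phi>(1)[OF a] \<phi>(1)[OF b]] \<phi>(2)[OF a] \<phi>(2)[OF b])
  qed (use a b \<phi>(1) in auto)
  then show ?thesis
    using \<phi>(1) by (auto simp: hom_def)
qed

text \<open>An arbitrary but fixed choice among the presenting semigroups. Being fixed, it labels an
  object in the same way wherever the object occurs as a domain or codomain.\<close>

definition semigroup_of :: "'a qsemigroup \<Rightarrow> 'a monoid" where
  "semigroup_of Q = (SOME S. presents S Q)"

definition morphism_of ::
  "'a qsemigroup \<times> ('a oper \<Rightarrow> 'a oper) \<times> 'a qsemigroup \<Rightarrow> 'a monoid \<times> ('a \<Rightarrow> 'a) \<times> 'a monoid" where
  "morphism_of = (\<lambda>(P, \<pi>, Q).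
    (semigroup_of P, hom_of (semigroup_of P) (semigroup_of Q) \<pi>, semigroup_of Q))"

lemma presents_semigroup_of: "Q \<in> qs_objects \<Longrightarrow> presents (semigroup_of Q) Q"
  unfolding semigroup_of_def qs_objects_iff by (rule someI_ex)

text \<open>The same \<open>S\<close> labels both ends; two different labellings of one object would
  turn the identity into a relabelling isomorphism.\<close>

lemma hom_of_ident:
  assumes S: "presents S P"
  shows "hom_of S S (\<lambda>x\<in>alg P. x) = (\<lambda>a\<in>carrier S. a)"
proof (rule extensionalityI[of _ "carrier S"])
  interpret cancellative_monoid S
    using S by (rule presentsD)
  fix a assume a: "a \<in> carrier S"
  have "hom_of S S (\<lambda>x\<in>alg P. x) a = a"
    using T_op_in_C_red[OF a] by (intro hom_of_eqI[OF S a a]) (simp add: presentsD(5)[OF S])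
  then show "hom_of S S (\<lambda>x\<in>alg P. x) a = (\<lambda>a\<in>carrier S. a) a"
    using a by simp
qed (simp_all add: hom_of_def)

text \<open>The middle object is labelled by the same \<open>R\<close> in both factors, so following
  T_a through \<pi> and then \<rho> composes the labels.\<close>

lemma hom_of_comp:
  assumes S: "presents S P" and R: "presents R Q" and U: "presents U V"
    and \<pi>: "\<pi> \<in> qs_hom P Q" and \<rho>: "\<rho> \<in> qs_hom Q V"
  shows "hom_of S U (compose (alg P) \<rho> \<pi>) = compose (carrier S) (hom_of R U \<rho>) (hom_of S R \<pi>)"
proof (rule extensionalityI[of _ "carrier S"])
  interpret S: cancellative_monoid S
    using S by (rule presentsD)
  fix a assume a: "a \<in> carrier S"
  note \<phi> = hom_of[OF S R \<pi> a]
  note \<psi> = hom_of[OF R U \<rho> \<phi>(1)]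
  have "compose (alg P) \<rho> \<pi> (T_op S a) = \<rho> (\<pi> (T_op S a))"
    using S.T_op_in_C_red[OF a] by (simp add: presentsD(5)[OF S] compose_eq)
  then have "hom_of S U (compose (alg P) \<rho> \<pi>) a = hom_of R U \<rho> (hom_of S R \<pi> a)"
    by (intro hom_of_eqI[OF U a \<psi>(1)]) (simp only: \<phi>(2) \<psi>(2))
  then show "hom_of S U (compose (alg P) \<rho> \<pi>) a =
      compose (carrier S) (hom_of R U \<rho>) (hom_of S R \<pi>) a"
    using a by (simp add: compose_eq)
qed (simp_all add: hom_of_def compose_extensional)

theorem theorem14:
  shows "\<exists>Fo Fm. injective_functor
    (QS_red :: ('a qsemigroup, 'a qsemigroup \<times> ('a oper \<Rightarrow> 'a oper) \<times> 'a qsemigroup) cat)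
    (S_ab :: ('a monoid, 'a monoid \<times> ('a \<Rightarrow> 'a) \<times> 'a monoid) cat)
    Fo Fm"
proof (intro exI)
  let ?QS = "QS_red :: ('a qsemigroup, 'a qsemigroup \<times> ('a oper \<Rightarrow> 'a oper) \<times> 'a qsemigroup) cat"
  let ?S = "S_ab :: ('a monoid, 'a monoid \<times> ('a \<Rightarrow> 'a) \<times> 'a monoid) cat"
  interpret C: category ?QS
    by (rule category_QS_red)
  interpret D: category ?S
    by (rule category_S_ab)
  note so = presents_semigroup_of
  \<comment> \<open>A semigroup presents at most one object, so the choice is injective no matter
    which presentations it picks.\<close>
  have inj_so: "P = Q" if "P \<in> qs_objects" "Q \<in> qs_objects" "semigroup_of P = semigroup_of Q"
    for P Q :: "'a qsemigroup"
    using so[OF that(1)] so[OF that(2)] that(3) presents_unique by metis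
  show "injective_functor ?QS ?S semigroup_of morphism_of"
  proof
    show "inj_on semigroup_of (Obj ?QS)"
      by (rule inj_onI) (simp add: QS_red_def inj_so)
    show "inj_on morphism_of (Arr ?QS)"
    proof (rule inj_onI)
      fix f g assume f: "f \<in> Arr ?QS" and g: "g \<in> Arr ?QS" and eq: "morphism_of f = morphism_of g"
      obtain P \<pi> Q where f': "f = (P, \<pi>, Q)"
        by (cases f)
      obtain P' \<pi>' Q' where g': "g = (P', \<pi>', Q')"
        by (cases g)
      have P: "P \<in> qs_objects" "Q \<in> qs_objects" and \<pi>: "\<pi> \<in> qs_hom P Q"
        and P': "P' \<in> qs_objects" "Q' \<in> qs_objects" and \<pi>': "\<pi>' \<in> qs_hom P' Q'"
        using f g by (simp_all add: f' g' QS_red_def)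
      \<comment> \<open>The image triple contains the chosen semigroups of both ends, so the objects
        are recovered before the maps are compared.\<close>
      have PQ: "P' = P" "Q' = Q"
        using eq inj_so[OF P'(1) P(1)] inj_so[OF P'(2) P(2)] by (auto simp: f' g' morphism_of_def)
      have eq': "hom_of (semigroup_of P) (semigroup_of Q) \<pi> = hom_of (semigroup_of P) (semigroup_of Q) \<pi>'"
        using eq by (simp add: f' g' PQ morphism_of_def)
      note hom = hom_of(2)[OF so[OF P(1)] so[OF P(2)]]
      \<comment> \<open>Equal labels mean that both maps send each T_a to the same translation, and
        a morphism is determined by these values.\<close>
      have "\<pi> = \<pi>'"
        by (rule qs_hom_eqI[OF so[OF P(1)] so[OF P(2)] \<pi> \<pi>'[unfolded PQ]])
          (simp only: hom[OF \<pi>] hom[OF \<pi>'[unfolded PQ]] eq')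
      then show "f = g"
        by (simp add: f' g' PQ)
    qed
  next
    fix X assume "X \<in> Obj ?QS"
    then have X: "X \<in> qs_objects"
      by (simp add: QS_red_def)
    show "semigroup_of X \<in> Obj ?S"
      using presentsD(1)[OF so[OF X]] by (simp add: S_ab_def)
    show "morphism_of (Ident ?QS X) = Ident ?S (semigroup_of X)"
      using hom_of_ident[OF so[OF X]] by (simp add: QS_red_def S_ab_def morphism_of_def)
  next
    fix f assume "f \<in> Arr ?QS"
    then obtain P \<pi> Q where f: "f = (P, \<pi>, Q)" and P: "P \<in> qs_objects" "Q \<in> qs_objects"
      and \<pi>: "\<pi> \<in> qs_hom P Q"
      by (auto simp: QS_red_def)
    show "morphism_of f \<in> Arr ?S"
      using hom_of_hom[OF so[OF P(1)] so[OF P(2)] \<pi>] presentsD(1)[OF so[OF P(1)]]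
        presentsD(1)[OF so[OF P(2)]]
      by (simp add: f morphism_of_def S_ab_def hom_of_def)
    show "Dom ?S (morphism_of f) = semigroup_of (Dom ?QS f)"
      "Cod ?S (morphism_of f) = semigroup_of (Cod ?QS f)"
      by (simp_all add: f QS_red_def S_ab_def morphism_of_def)
    fix g assume "g \<in> Arr ?QS" "Cod ?QS f = Dom ?QS g"
    then obtain R \<rho> where g: "g = (Q, \<rho>, R)" and R: "R \<in> qs_objects" and \<rho>: "\<rho> \<in> qs_hom Q R"
      by (auto simp: f QS_red_def)
    show "morphism_of (Comp ?QS g f) = Comp ?S (morphism_of g) (morphism_of f)"
      using hom_of_comp[OF so[OF P(1)] so[OF P(2)] so[OF R] \<pi> \<rho>]
      by (simp add: f g QS_red_def S_ab_def morphism_of_def)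
  qed
qed

end
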